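(* Let $R$ be a nonzero ring, let $n$ be a positive integer and let $\sigma\colon R\to M_n(R)$ be a ring homomorphism. The following statements are equivalent: (a) $\sigma$ is megainjective. (b) $\deg$ is a degree-function on $R\langle x_1,\dots,x_n;\sigma,\delta\rangle$ for any right $\sigma$-derivation $\delta$. (c) $R\langle x_1,\dots,x_n;\sigma,0\rangle$ is a domain, where $0$ denotes the zero $\sigma$-derivation. In particular, if $R\langle x_1,\dots,x_n;\sigma,0\rangle$ is a domain, then so is $R\langle x_1,\dots,x_n;\sigma,\delta\rangle$ for any right $\sigma$-derivation $\delta$.
   Context: Rings are associative with identity element; ring homomorphisms preserve the identity; modules are unital. $R^n$ denotes row vectors with $n$ entries in $R$. For a ring homomorphism $\sigma\colon R\to M_n(R)$, a right $\sigma$-derivation is an additive map $\delta\colon R\to R^n$ with $\delta(rs)=\delta(r)\sigma(s)+r\delta(s)$ for all $r,s\in R$ (matrix product in the first term). Write $\sigma_{ij}(r)$ for the $(i,j)$-entry of $\sigma(r)$ and $\delta_j(r)$ for the $j$-th component of $\delta(r)$. The $(\sigma,\delta)$-free skew extension $S=R\langle x_1,\dots,x_n;\sigma,\delta\rangle$ of $R$ is a ring (unique up to isomorphism) containing $R$ as a subring and an $n$-element subset $X=\{x_1,\dots,x_n\}$ such that (i) the submonoid $\langle X\rangle$ of the multiplicative monoid of $S$ generated by $X$ is free on $X$; (ii) $S$ is a free right $R$-module with basis $\langle X\rangle$; (iii) $rx_j=\sum_{i=1}^n x_i\sigma_{ij}(r)+\delta_j(r)$ for all $j$ and all $r\in R$.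 The length of $w=x_{i_1}\cdots x_{i_r}\in\langle X\rangle$ is $|w|=r$, with $|1|=0$. For $m\ge 0$, $S_m$ is the right $R$-submodule of $S$ generated by all monomials in $\langle X\rangle$ of length $\le m$, and $S_{-\infty}=\{0\}$. Define $\deg\colon S\to\mathbb{N}\cup\{-\infty\}$ by $\deg(f)=\min\{m\mid f\in S_m\}$. It is a pseudo-valuation ($\deg(f)\ge 0$ for $f\ne 0$, $\deg(0)=-\infty$, $\deg(f-g)\le\max\{\deg f,\deg g\}$, $\deg(fg)\le\deg f+\deg g$, $\deg(1)=0$), and is called a degree-function if $\deg(fg)=\deg(f)+\deg(g)$ for all $f,g\in S$. Define ring homomorphisms $\sigma^{(r)}\colon R\to M_{n^r}(R)$, $r\ge 1$, by $\sigma^{(1)}=\sigma$ and, if $\sigma^{(r)}(a)=(a_{kl})$, then $\sigma^{(r+1)}(a)$ is the $n^{r+1}\times n^{r+1}$ matrix whose $(k,l)$ block of size $n\times n$ is $\sigma(a_{kl})$. The homomorphism $\sigma$ is megainjective if for all $a\in R\setminus\{0\}$ and $r\ge 1$, $\sigma^{(r)}(a)$ is neither the zero matrix nor a left zero divisor in $M_{n^r}(R)$; equivalently, the columns of $\sigma^{(r)}(a)$ are right $R$-linearly independent. *)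

theory Defs
  imports
    "Jordan_Normal_Form.VS_Connect"
    "HOL-Library.Extended"
    "HOL-Library.Poly_Mapping"
begin

text \<open>
  The base ring \<open>R\<close> is the type \<open>'a::ring_1\<close> (which is nonzero), also used as the record
  \<^const>\<open>class_ring\<close>; row vectors in \<open>R\<^sup>n\<close> are \<open>1 \<times> n\<close> matrices. Indices run over \<open>{..<n}\<close>
  instead of \<open>{1..n}\<close>.
\<close>

definition right_derivation ::
    "nat \<Rightarrow> ('a::ring_1 \<Rightarrow> 'a mat) \<Rightarrow> ('a \<Rightarrow> 'a mat) \<Rightarrow> bool" where
  "right_derivation n \<sigma> \<delta> \<longleftrightarrow>
     (\<forall>r. \<delta> r \<in> carrier_mat 1 n) \<and>
     (\<forall>r s. \<delta> (r + s) = \<delta> r + \<delta> s) \<and>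
     (\<forall>r s. \<delta> (r * s) = \<delta> r * \<sigma> s + r \<cdot>\<^sub>m \<delta> s)"

definition zero_derivation :: "nat \<Rightarrow> 'a::ring_1 \<Rightarrow> 'a mat" where
  "zero_derivation n = (\<lambda>_. 0\<^sub>m 1 n)"

text \<open>
  Division and remainder by \<open>n\<close> locate the \<open>n \<times> n\<close> block of an entry and the position inside
  this block. The value for exponent \<open>0\<close> is a dummy.
\<close>

fun hom_power :: "nat \<Rightarrow> ('a::ring_1 \<Rightarrow> 'a mat) \<Rightarrow> nat \<Rightarrow> 'a \<Rightarrow> 'a mat" where
  "hom_power n \<sigma> 0 a = mat 1 1 (\<lambda>_. a)"
| "hom_power n \<sigma> (Suc 0) a = \<sigma> a"
| "hom_power n \<sigma> (Suc (Suc r)) a =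
     mat (n ^ Suc (Suc r)) (n ^ Suc (Suc r))
       (\<lambda>(i, j). \<sigma> (hom_power n \<sigma> (Suc r) a $$ (i div n, j div n)) $$ (i mod n, j mod n))"

definition left_zero_divisor_mat :: "nat \<Rightarrow> 'a::ring_1 mat \<Rightarrow> bool" where
  "left_zero_divisor_mat m A \<longleftrightarrow> (\<exists>B \<in> carrier_mat m m. B \<noteq> 0\<^sub>m m m \<and> A * B = 0\<^sub>m m m)"

definition megainjective :: "nat \<Rightarrow> ('a::ring_1 \<Rightarrow> 'a mat) \<Rightarrow> bool" where
  "megainjective n \<sigma> \<longleftrightarrow>
     (\<forall>a r. a \<noteq> 0 \<longrightarrow> r \<ge> 1 \<longrightarrow>
        hom_power n \<sigma> r a \<noteq> 0\<^sub>m (n ^ r) (n ^ r) \<and>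
        \<not> left_zero_divisor_mat (n ^ r) (hom_power n \<sigma> r a))"

text \<open>
  For an embedding \<open>\<iota>\<close> of \<open>R\<close> into a ring \<open>S\<close>, the right \<open>R\<close>-module structure of \<open>S\<close> is
  \<open>f \<cdot> r = f \<otimes> \<iota> r\<close>.
\<close>

definition right_span :: "('b, 'm) ring_scheme \<Rightarrow> ('a \<Rightarrow> 'b) \<Rightarrow> 'b set \<Rightarrow> 'b set" where
  "right_span S \<iota> B =
     {f. \<exists>A c. finite A \<and> A \<subseteq> B \<and> f = (\<Oplus>\<^bsub>S\<^esub>b\<in>A. b \<otimes>\<^bsub>S\<^esub> \<iota> (c b))}"

definition right_independent ::
    "('b, 'm) ring_scheme \<Rightarrow> ('a::zero \<Rightarrow> 'b) \<Rightarrow> 'b set \<Rightarrow> bool" where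
  "right_independent S \<iota> B \<longleftrightarrow>
     (\<forall>A c. finite A \<longrightarrow> A \<subseteq> B \<longrightarrow> (\<Oplus>\<^bsub>S\<^esub>b\<in>A. b \<otimes>\<^bsub>S\<^esub> \<iota> (c b)) = \<zero>\<^bsub>S\<^esub> \<longrightarrow> (\<forall>b\<in>A. c b = 0))"

definition right_basis ::
    "('b, 'm) ring_scheme \<Rightarrow> ('a::zero \<Rightarrow> 'b) \<Rightarrow> 'b set \<Rightarrow> bool" where
  "right_basis S \<iota> B \<longleftrightarrow>
     B \<subseteq> carrier S \<and> right_independent S \<iota> B \<and> right_span S \<iota> B = carrier S"

definition word_prod :: "('b, 'm) ring_scheme \<Rightarrow> (nat \<Rightarrow> 'b) \<Rightarrow> nat list \<Rightarrow> 'b" where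
  "word_prod S x w = foldr (\<lambda>i f. x i \<otimes>\<^bsub>S\<^esub> f) w \<one>\<^bsub>S\<^esub>"

text \<open>
  The lists over \<open>{..<n}\<close> form the free monoid on \<open>n\<close> letters, and \<^const>\<open>word_prod\<close> is its
  canonical homomorphism onto the submonoid generated by the \<open>x\<^sub>i\<close>; hence that submonoid is
  free on the \<open>x\<^sub>i\<close> iff this map is injective.
\<close>

locale free_skew_extension = ring S for S :: "('b, 'm) ring_scheme" (structure) +
  fixes n :: nat
    and \<sigma> :: "'a::ring_1 \<Rightarrow> 'a mat"
    and \<delta> :: "'a \<Rightarrow> 'a mat"
    and \<iota> :: "'a \<Rightarrow> 'b"
    and x :: "nat \<Rightarrow> 'b"
  assumes embedding_hom: "\<iota> \<in> Ring.ring_hom class_ring S"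
    and embedding_inj: "inj \<iota>"
    and generators_closed: "x \<in> {..<n} \<rightarrow> carrier S"
    and generators_distinct: "inj_on x {..<n}"
    and monoid_free: "inj_on (word_prod S x) (lists {..<n})"
    and monoid_basis: "right_basis S \<iota> (word_prod S x ` lists {..<n})"
    and commutation: "\<And>r j. j < n \<Longrightarrow>
      \<iota> r \<otimes> x j = (\<Oplus>i\<in>{..<n}. x i \<otimes> \<iota> (\<sigma> r $$ (i, j))) \<oplus> \<iota> (\<delta> r $$ (0, j))"

text \<open>
  Because the words are unique, the length of a monomial is the length of the word it comes from.
\<close>

definition deg_filtration ::
    "('b, 'm) ring_scheme \<Rightarrow> nat \<Rightarrow> ('a \<Rightarrow> 'b) \<Rightarrow> (nat \<Rightarrow> 'b) \<Rightarrow> nat \<Rightarrow> 'b set" where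
  "deg_filtration S n \<iota> x m =
     right_span S \<iota> (word_prod S x ` {w \<in> lists {..<n}. length w \<le> m})"

definition skew_deg ::
    "('b, 'm) ring_scheme \<Rightarrow> nat \<Rightarrow> ('a \<Rightarrow> 'b) \<Rightarrow> (nat \<Rightarrow> 'b) \<Rightarrow> 'b \<Rightarrow> nat extended" where
  "skew_deg S n \<iota> x f =
     (if f = \<zero>\<^bsub>S\<^esub> then Minf else Fin (LEAST m. f \<in> deg_filtration S n \<iota> x m))"

definition pseudo_valuation :: "('b, 'm) ring_scheme \<Rightarrow> ('b \<Rightarrow> nat extended) \<Rightarrow> bool" where
  "pseudo_valuation S d \<longleftrightarrow>
     (\<forall>f \<in> carrier S. d f \<noteq> Pinf) \<and>
     (\<forall>f \<in> carrier S. f \<noteq> \<zero>\<^bsub>S\<^esub> \<longrightarrow> d f \<ge> 0) \<and>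
     d \<zero>\<^bsub>S\<^esub> = Minf \<and>
     (\<forall>f \<in> carrier S. \<forall>g \<in> carrier S. d (f \<ominus>\<^bsub>S\<^esub> g) \<le> max (d f) (d g)) \<and>
     (\<forall>f \<in> carrier S. \<forall>g \<in> carrier S. d (f \<otimes>\<^bsub>S\<^esub> g) \<le> d f + d g) \<and>
     d \<one>\<^bsub>S\<^esub> = 0"

definition degree_function :: "('b, 'm) ring_scheme \<Rightarrow> ('b \<Rightarrow> nat extended) \<Rightarrow> bool" where
  "degree_function S d \<longleftrightarrow>
     pseudo_valuation S d \<and>
     (\<forall>f \<in> carrier S. \<forall>g \<in> carrier S. d (f \<otimes>\<^bsub>S\<^esub> g) = d f + d g)"

text \<open>The locale \<^locale>\<open>domain\<close> requires commutativity, which is not wanted here.\<close>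

definition noncomm_domain :: "('b, 'm) ring_scheme \<Rightarrow> bool" where
  "noncomm_domain S \<longleftrightarrow>
     ring S \<and> \<one>\<^bsub>S\<^esub> \<noteq> \<zero>\<^bsub>S\<^esub> \<and>
     (\<forall>f \<in> carrier S. \<forall>g \<in> carrier S. f \<otimes>\<^bsub>S\<^esub> g = \<zero>\<^bsub>S\<^esub> \<longrightarrow> f = \<zero>\<^bsub>S\<^esub> \<or> g = \<zero>\<^bsub>S\<^esub>)"

text \<open>
  Existence of the free skew extension, for every \<open>\<sigma>\<close> and \<open>\<delta>\<close>: the finitely supported functions
  from words to \<open>R\<close>, where \<open>single w r\<close> is the element \<open>w r\<close>, carry a suitable product. Since the
  words form a right basis, a free skew extension has the cardinality of the set of
  these functions; so up to isomorphism every free skew extension of \<open>R\<close> has its carrier in the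
  type \<open>nat list \<Rightarrow>\<^sub>0 'a\<close>, and quantifying over ring structures on subsets of this type
  loses nothing.

  Left multiplication by \<open>x\<^sub>i\<close> is \<open>skew_pre i\<close>, and left multiplication by \<open>r\<close> is \<open>skew_act r\<close>, which
  on words is computed with the commutation rule from left to right. Letters outside \<open>{..<n}\<close>, which
  do not occur in the carrier, are killed by the latter, so that associativity holds on the whole type.
\<close>

abbreviation skew_lin :: "(nat list \<Rightarrow> 'a::ring_1 \<Rightarrow> (nat list \<Rightarrow>\<^sub>0 'a)) \<Rightarrow> (nat list \<Rightarrow>\<^sub>0 'a) \<Rightarrow> nat list \<Rightarrow>\<^sub>0 'a" where
  "skew_lin g f \<equiv> (\<Sum>w\<in>Poly_Mapping.keys f. g w (Poly_Mapping.lookup f w))"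

definition skew_pre :: "nat \<Rightarrow> (nat list \<Rightarrow>\<^sub>0 'a::ring_1) \<Rightarrow> nat list \<Rightarrow>\<^sub>0 'a" where
  "skew_pre i f = skew_lin (\<lambda>w. Poly_Mapping.single (i # w)) f"

primrec skew_act_word :: "nat \<Rightarrow> ('a::ring_1 \<Rightarrow> 'a mat) \<Rightarrow> ('a \<Rightarrow> 'a mat) \<Rightarrow> nat list \<Rightarrow> 'a \<Rightarrow> 'a \<Rightarrow> (nat list \<Rightarrow>\<^sub>0 'a)" where
  "skew_act_word n \<sigma> \<delta> [] = (\<lambda>r s. Poly_Mapping.single [] (r * s))"
| "skew_act_word n \<sigma> \<delta> (j # w) = (\<lambda>r s. if j < n
     then (\<Sum>i<n. skew_pre i (skew_act_word n \<sigma> \<delta> w (\<sigma> r $$ (i, j)) s)) + skew_act_word n \<sigma> \<delta> w (\<delta> r $$ (0, j)) s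
     else 0)"

definition skew_act :: "nat \<Rightarrow> ('a::ring_1 \<Rightarrow> 'a mat) \<Rightarrow> ('a \<Rightarrow> 'a mat) \<Rightarrow> 'a \<Rightarrow> (nat list \<Rightarrow>\<^sub>0 'a) \<Rightarrow> nat list \<Rightarrow>\<^sub>0 'a" where
  "skew_act n \<sigma> \<delta> r f = skew_lin (\<lambda>w. skew_act_word n \<sigma> \<delta> w r) f"

definition skew_mult :: "nat \<Rightarrow> ('a::ring_1 \<Rightarrow> 'a mat) \<Rightarrow> ('a \<Rightarrow> 'a mat) \<Rightarrow> (nat list \<Rightarrow>\<^sub>0 'a) \<Rightarrow> (nat list \<Rightarrow>\<^sub>0 'a) \<Rightarrow> nat list \<Rightarrow>\<^sub>0 'a" where
  "skew_mult n \<sigma> \<delta> f g = skew_lin (\<lambda>u s. foldr skew_pre u (skew_act n \<sigma> \<delta> s g)) f"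

definition skew_ring :: "nat \<Rightarrow> ('a::ring_1 \<Rightarrow> 'a mat) \<Rightarrow> ('a \<Rightarrow> 'a mat) \<Rightarrow> (nat list \<Rightarrow>\<^sub>0 'a) ring" where
  "skew_ring n \<sigma> \<delta> = \<lparr>carrier = {f. Poly_Mapping.keys f \<subseteq> lists {..<n}}, mult = skew_mult n \<sigma> \<delta>,
     one = Poly_Mapping.single [] 1, zero = 0, add = (+)\<rparr>"

definition is_additive :: "('b::ab_group_add \<Rightarrow> 'c::ab_group_add) \<Rightarrow> bool" where
  "is_additive h \<longleftrightarrow> (\<forall>f g. h (f + g) = h f + h g)"

lemma is_additiveD: "is_additive h \<Longrightarrow> h (f + g) = h f + h g" by (simp add: is_additive_def)

lemma is_additive_0: "is_additive h \<Longrightarrow> h 0 = 0"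
  by (metis is_additive_def add_cancel_right_right)

lemma is_additive_sum: assumes "is_additive h" shows "h (sum f A) = (\<Sum>a\<in>A. h (f a))"
  by (induction A rule: infinite_finite_induct) (simp_all add: is_additive_0[OF assms] is_additiveD[OF assms])

lemma is_additive_single: "is_additive (Poly_Mapping.single w)"
  by (simp add: is_additive_def single_add)

lemma lin_add: assumes "\<And>w. is_additive (g w)" shows "is_additive (skew_lin g)"
  unfolding is_additive_def
  by (intro allI setsum_keys_plus_distrib) (simp_all add: is_additive_0[OF assms] is_additiveD[OF assms])

lemma lin_single: assumes "\<And>w. is_additive (g w)" shows "skew_lin g (Poly_Mapping.single w r) = g w r"
  using is_additive_0[OF assms] by (cases "r = 0") simp_all

lemma pm_expand: "f = (\<Sum>w\<in>Poly_Mapping.keys f. Poly_Mapping.single w (Poly_Mapping.lookup f w))"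
proof (rule poly_mapping_eqI)
  fix k
  show "Poly_Mapping.lookup f k = Poly_Mapping.lookup (\<Sum>w\<in>Poly_Mapping.keys f. Poly_Mapping.single w (Poly_Mapping.lookup f w)) k"
    by (cases "k \<in> Poly_Mapping.keys f") (simp_all add: lookup_sum lookup_single when_def in_keys_iff)
qed

lemma add_eqI:
  fixes \<phi> \<psi> :: "(nat list \<Rightarrow>\<^sub>0 'a::ring_1) \<Rightarrow> 'c::ab_group_add"
  assumes "is_additive \<phi>" "is_additive \<psi>"
    and "\<And>w r. w \<in> Poly_Mapping.keys f \<Longrightarrow> \<phi> (Poly_Mapping.single w r) = \<psi> (Poly_Mapping.single w r)"
  shows "\<phi> f = \<psi> f"
proof -
  have "\<phi> f = (\<Sum>w\<in>Poly_Mapping.keys f. \<phi> (Poly_Mapping.single w (Poly_Mapping.lookup f w)))"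
    using pm_expand[of f] is_additive_sum[OF assms(1)] by metis
  also have "\<dots> = (\<Sum>w\<in>Poly_Mapping.keys f. \<psi> (Poly_Mapping.single w (Poly_Mapping.lookup f w)))"
    using assms(3) by (intro sum.cong) auto
  also have "\<dots> = \<psi> f" using pm_expand[of f] is_additive_sum[OF assms(2)] by metis
  finally show ?thesis .
qed

lemma is_additive_comp: "is_additive f \<Longrightarrow> is_additive g \<Longrightarrow> is_additive (\<lambda>x. f (g x))"
  by (simp add: is_additive_def)

lemma is_additive_plus: "is_additive f \<Longrightarrow> is_additive g \<Longrightarrow> is_additive (\<lambda>x. f x + g x)"
  by (simp add: is_additive_def algebra_simps)

lemma is_additive_bigsum: "(\<And>i. is_additive (f i)) \<Longrightarrow> is_additive (\<lambda>x. \<Sum>i\<in>A. f i x)"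
  by (simp add: is_additive_def sum.distrib)

lemma pre_add: "is_additive (skew_pre i)"
  unfolding skew_pre_def by (rule lin_add) (rule is_additive_single)

lemma pre_single: "skew_pre i (Poly_Mapping.single w r) = Poly_Mapping.single (i # w) r"
  unfolding skew_pre_def by (rule lin_single) (rule is_additive_single)

lemma single_one_inj: "Poly_Mapping.single u (1::'a::zero_neq_one) = Poly_Mapping.single w 1 \<Longrightarrow> u = w"
  by (drule arg_cong[of _ _ Poly_Mapping.keys]) simp

lemma foldr_pre_add: "is_additive (foldr skew_pre u)"
proof (induction u)
  case Nil show ?case by (simp add: is_additive_def)
next
  case (Cons i u)
  then show ?case using is_additive_comp[OF pre_add[of i] Cons] by (simp add: comp_def is_additive_def)
qed

lemma foldr_pre_single: "foldr skew_pre u (Poly_Mapping.single w r) = Poly_Mapping.single (u @ w) r"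
  by (induction u) (simp_all add: pre_single)

context
  fixes n :: nat and \<sigma> \<delta> :: "'a::ring_1 \<Rightarrow> 'a mat"
  assumes hom: "\<sigma> \<in> Ring.ring_hom class_ring (ring_mat TYPE('a) n ())"
    and der: "right_derivation n \<sigma> \<delta>"
begin

lemma sig_carrier: "\<sigma> r \<in> carrier_mat n n"
  using hom by (auto simp: Ring.ring_hom_def ring_mat_simps)

lemma sig_dim [simp]: "dim_row (\<sigma> r) = n" "dim_col (\<sigma> r) = n"
  using sig_carrier[of r] by auto

lemma del_dim [simp]: "dim_row (\<delta> r) = 1" "dim_col (\<delta> r) = n"
  using der unfolding right_derivation_def by auto

lemma sig_add: "i < n \<Longrightarrow> j < n \<Longrightarrow> \<sigma> (r + s) $$ (i, j) = \<sigma> r $$ (i, j) + \<sigma> s $$ (i, j)"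
  using hom by (auto simp: Ring.ring_hom_def ring_mat_simps)

lemma sig_mult: "i < n \<Longrightarrow> j < n \<Longrightarrow> \<sigma> (r * s) $$ (i, j) = (\<Sum>k<n. \<sigma> r $$ (i, k) * \<sigma> s $$ (k, j))"
  using hom by (auto simp: Ring.ring_hom_def ring_mat_simps scalar_prod_def atLeast0LessThan)

lemma sig_one: "i < n \<Longrightarrow> j < n \<Longrightarrow> \<sigma> 1 $$ (i, j) = (if i = j then 1 else 0)"
  using hom by (auto simp: Ring.ring_hom_def ring_mat_simps)

lemma del_add: "j < n \<Longrightarrow> \<delta> (r + s) $$ (0, j) = \<delta> r $$ (0, j) + \<delta> s $$ (0, j)"
  using der by (auto simp: right_derivation_def)

lemma del_mult: "j < n \<Longrightarrow> \<delta> (r * s) $$ (0, j) = (\<Sum>k<n. \<delta> r $$ (0, k) * \<sigma> s $$ (k, j)) + r * \<delta> s $$ (0, j)"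
proof -
  assume j: "j < n"
  have "\<delta> (r * s) = \<delta> r * \<sigma> s + r \<cdot>\<^sub>m \<delta> s" using der by (simp add: right_derivation_def)
  then show ?thesis using j by (simp add: scalar_prod_def atLeast0LessThan)
qed

lemma del_one: "j < n \<Longrightarrow> \<delta> 1 $$ (0, j) = 0"
  using del_mult[of j 1 1] by (simp add: sig_one if_distrib cong: if_cong)

private abbreviation "A \<equiv> skew_act n \<sigma> \<delta>"
private abbreviation "W \<equiv> skew_act_word n \<sigma> \<delta>"
private abbreviation "M \<equiv> skew_mult n \<sigma> \<delta>"

lemma W_add: "is_additive (W w r)"
proof (induction w arbitrary: r)
  case Nil then show ?case by (simp add: is_additive_def distrib_left single_add)
next
  case (Cons j w)
  have "is_additive (\<lambda>s. (\<Sum>i<n. skew_pre i (W w (\<sigma> r $$ (i, j)) s)) + W w (\<delta> r $$ (0, j)) s)"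
    by (intro is_additive_plus is_additive_bigsum is_additive_comp[OF pre_add] Cons)
  then show ?case by (cases "j < n") (simp_all add: is_additive_def)
qed

lemma A_add: "is_additive (A r)" unfolding skew_act_def by (rule lin_add) (rule W_add)

lemma A_single: "A r (Poly_Mapping.single w s) = W w r s"
  unfolding skew_act_def by (rule lin_single) (rule W_add)

lemma W_add_left: "W w (r + t) s = W w r s + W w t s"
proof (induction w arbitrary: r t)
  case Nil then show ?case by (simp add: distrib_right single_add)
next
  case (Cons j w)
  then show ?case
    by (simp add: sig_add del_add is_additiveD[OF pre_add] sum.distrib algebra_simps)
qed

lemma A_add_left: "is_additive (\<lambda>r. A r f)"
  unfolding is_additive_def skew_act_def by (simp add: W_add_left sum.distrib)

lemma A_pre: "A r (skew_pre j h) =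
    (if j < n then (\<Sum>i<n. skew_pre i (A (\<sigma> r $$ (i, j)) h)) + A (\<delta> r $$ (0, j)) h else 0)"
proof (rule add_eqI[of "\<lambda>h. A r (skew_pre j h)"])
  show "is_additive (\<lambda>h. A r (skew_pre j h))" by (rule is_additive_comp[OF A_add pre_add])
  show "is_additive (\<lambda>h. if j < n then (\<Sum>i<n. skew_pre i (A (\<sigma> r $$ (i, j)) h)) + A (\<delta> r $$ (0, j)) h else 0)"
    by (cases "j < n") (simp_all add: is_additive_plus is_additive_bigsum is_additive_comp[OF pre_add] A_add,
      simp add: is_additive_def)
qed (simp add: A_single pre_single)

lemma A_mult: "A (r * t) h = A r (A t h)"
proof (rule add_eqI[OF A_add is_additive_comp[OF A_add A_add]])
  fix w s
  show "A (r * t) (Poly_Mapping.single w s) = A r (A t (Poly_Mapping.single w s))"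
  proof (induction w arbitrary: r t)
    case Nil then show ?case by (simp add: A_single mult.assoc)
  next
    case (Cons j w)
    let ?h = "Poly_Mapping.single w s"
    have e: "Poly_Mapping.single (j # w) s = skew_pre j ?h" by (simp add: pre_single)
    show ?case
    proof (cases "j < n")
      case False then show ?thesis by (simp add: e A_pre is_additive_0[OF A_add])
    next
      case j: True
      have "A r (A t (skew_pre j ?h)) = (\<Sum>k<n. A r (skew_pre k (A (\<sigma> t $$ (k, j)) ?h))) + A r (A (\<delta> t $$ (0, j)) ?h)"
        using j by (simp add: A_pre is_additiveD[OF A_add] is_additive_sum[OF A_add])
      also have "\<dots> = (\<Sum>k<n. (\<Sum>i<n. skew_pre i (A (\<sigma> r $$ (i, k) * \<sigma> t $$ (k, j)) ?h)) + A (\<delta> r $$ (0, k) * \<sigma> t $$ (k, j)) ?h)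
           + A (r * \<delta> t $$ (0, j)) ?h"
        by (simp add: A_pre Cons)
      also have "\<dots> = (\<Sum>i<n. \<Sum>k<n. skew_pre i (A (\<sigma> r $$ (i, k) * \<sigma> t $$ (k, j)) ?h)) + ((\<Sum>k<n. A (\<delta> r $$ (0, k) * \<sigma> t $$ (k, j)) ?h)
           + A (r * \<delta> t $$ (0, j)) ?h)"
        by (subst sum.swap) (simp add: sum.distrib add.assoc)
      also have "\<dots> = A (r * t) (skew_pre j ?h)"
        using j by (simp add: A_pre sig_mult del_mult is_additive_sum[OF A_add_left] is_additive_sum[OF pre_add] is_additiveD[OF A_add_left])
      finally show ?thesis by (simp add: e)
    qed
  qed
qed

lemma A_zero: "A 0 f = 0" by (rule is_additive_0[OF A_add_left])

lemma M_add_left: "is_additive (\<lambda>f. M f g)"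
  unfolding skew_mult_def
  by (rule lin_add) (rule is_additive_comp[OF foldr_pre_add A_add_left])

lemma M_single: "M (Poly_Mapping.single u s) g = foldr skew_pre u (A s g)"
  unfolding skew_mult_def
  by (rule lin_single) (rule is_additive_comp[OF foldr_pre_add A_add_left])

lemma M_add_right: "is_additive (M f)"
  unfolding skew_mult_def
  by (rule is_additive_bigsum) (rule is_additive_comp[OF foldr_pre_add A_add])

lemma M_pre: "M (skew_pre i f) h = skew_pre i (M f h)"
  by (rule add_eqI[OF is_additive_comp[OF M_add_left pre_add] is_additive_comp[OF pre_add M_add_left]])
    (simp add: pre_single M_single)

lemma M_foldr_pre: "M (foldr skew_pre u f) h = foldr skew_pre u (M f h)"
  by (induction u) (simp_all add: M_pre)

lemma M_A: "M (A r g) h = A r (M g h)"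
proof (rule add_eqI[OF is_additive_comp[OF M_add_left A_add] is_additive_comp[OF A_add M_add_left]])
  fix w s
  show "M (A r (Poly_Mapping.single w s)) h = A r (M (Poly_Mapping.single w s) h)"
  proof (induction w arbitrary: r)
    case Nil then show ?case by (simp add: A_single M_single A_mult)
  next
    case (Cons j w)
    have e: "Poly_Mapping.single (j # w) s = skew_pre j (Poly_Mapping.single w s)" by (simp add: pre_single)
    show ?case
      unfolding e M_pre A_pre
      by (simp add: is_additiveD[OF M_add_left] is_additive_sum[OF M_add_left] M_pre Cons is_additive_0[OF M_add_left])
  qed
qed

lemma M_assoc: "M (M f g) h = M f (M g h)"
  by (rule add_eqI[OF is_additive_comp[OF M_add_left M_add_left] M_add_left])
    (simp add: M_single M_foldr_pre M_A)

private definition "C = {f :: nat list \<Rightarrow>\<^sub>0 'a. Poly_Mapping.keys f \<subseteq> lists {..<n}}"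

lemma C_add: "f \<in> C \<Longrightarrow> g \<in> C \<Longrightarrow> f + g \<in> C"
  unfolding C_def using keys_add[of f g] by blast

lemma C_0: "0 \<in> C" by (simp add: C_def)

lemma C_uminus: "f \<in> C \<Longrightarrow> - f \<in> C" by (simp add: C_def)

lemma C_sum: "(\<And>a. a \<in> X \<Longrightarrow> f a \<in> C) \<Longrightarrow> sum f X \<in> C"
  by (induction X rule: infinite_finite_induct) (simp_all add: C_0 C_add)

lemma C_single: "w \<in> lists {..<n} \<Longrightarrow> Poly_Mapping.single w r \<in> C"
  by (cases "r = 0") (simp_all add: C_def)

lemma C_pre: "i < n \<Longrightarrow> f \<in> C \<Longrightarrow> skew_pre i f \<in> C"
  unfolding skew_pre_def by (rule C_sum, rule C_single) (auto simp: C_def)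

lemma C_W: "w \<in> lists {..<n} \<Longrightarrow> W w r s \<in> C"
proof (induction w arbitrary: r)
  case Nil then show ?case by (simp add: C_single)
next
  case (Cons j w) then show ?case by (auto intro!: C_add C_sum C_pre)
qed

lemma C_A: "f \<in> C \<Longrightarrow> A r f \<in> C"
  unfolding skew_act_def by (rule C_sum, rule C_W) (auto simp: C_def)

lemma C_foldr_pre: "u \<in> lists {..<n} \<Longrightarrow> f \<in> C \<Longrightarrow> foldr skew_pre u f \<in> C"
  by (induction u) (auto intro!: C_pre)

lemma C_M: "f \<in> C \<Longrightarrow> g \<in> C \<Longrightarrow> M f g \<in> C"
  unfolding skew_mult_def by (rule C_sum, rule C_foldr_pre[OF _ C_A]) (auto simp: C_def)

lemma W_one: "w \<in> lists {..<n} \<Longrightarrow> W w 1 s = Poly_Mapping.single w s"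
proof (induction w)
  case Nil then show ?case by simp
next
  case (Cons j w)
  then have j: "j < n" and w: "w \<in> lists {..<n}" by auto
  have z: "W w 0 s = 0" using A_zero A_single by metis
  have "(\<Sum>i<n. skew_pre i (W w (\<sigma> 1 $$ (i, j)) s)) = (\<Sum>i<n. if i = j then Poly_Mapping.single (j # w) s else 0)"
    using j Cons.IH[OF w] z by (intro sum.cong) (auto simp: sig_one pre_single is_additive_0[OF pre_add])
  then show ?case using j z by (simp add: del_one)
qed

lemma A_one: "f \<in> C \<Longrightarrow> A 1 f = f"
  by (rule add_eqI[OF A_add, of "\<lambda>f. f"]) (auto simp: is_additive_def A_single C_def intro!: W_one)

lemma M_one_left: "f \<in> C \<Longrightarrow> M (Poly_Mapping.single [] 1) f = f"
  by (simp add: M_single A_one)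

lemma M_single_const: "M (Poly_Mapping.single w r) (Poly_Mapping.single [] s) = Poly_Mapping.single w (r * s)"
  by (simp add: M_single A_single foldr_pre_single)

lemma M_one_right: "M f (Poly_Mapping.single [] 1) = f"
  by (rule add_eqI[OF M_add_left, of "\<lambda>f. f"]) (auto simp: is_additive_def M_single_const)

private abbreviation "S \<equiv> skew_ring n \<sigma> \<delta>"

lemma S_simps:
  "carrier S = C" "mult S = M" "one S = Poly_Mapping.single [] 1" "zero S = 0" "add S = (+)"
  by (simp_all add: skew_ring_def C_def)

lemma ring_S: "ring S"
proof (rule ringI)
  show "abelian_group S"
    by (rule abelian_groupI) (auto simp: S_simps C_0 C_add add.assoc add.commute intro!: bexI[OF _ C_uminus])
  show "Group.monoid S"
    by (rule monoidI) (auto simp: S_simps C_M C_single M_assoc M_one_left M_one_right)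
qed (auto simp: S_simps is_additiveD[OF M_add_left] is_additiveD[OF M_add_right])

lemma finsum_S: "(\<And>a. a \<in> X \<Longrightarrow> f a \<in> C) \<Longrightarrow> finsum S f X = sum f X"
proof -
  interpret S: ring S by (rule ring_S)
  show "(\<And>a. a \<in> X \<Longrightarrow> f a \<in> C) \<Longrightarrow> finsum S f X = sum f X"
  proof (induction X rule: infinite_finite_induct)
    case (insert a X)
    then show ?case by (subst S.finsum_insert) (auto simp: S_simps)
  next
    case (infinite X) then show ?case by (simp add: S_simps)
  next
    case empty then show ?case by (simp add: S_simps)
  qed
qed

lemma word_prod_S: "w \<in> lists {..<n} \<Longrightarrow> word_prod S (\<lambda>i. Poly_Mapping.single [i] 1) w = Poly_Mapping.single w 1"
  by (induction w) (auto simp: word_prod_def S_simps M_single A_one C_single pre_single)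

lemma basis_S: "right_basis S (Poly_Mapping.single []) (word_prod S (\<lambda>i. Poly_Mapping.single [i] 1) ` lists {..<n})"
proof -
  let ?m = "\<lambda>w. Poly_Mapping.single w (1::'a)"
  let ?\<iota> = "Poly_Mapping.single [] :: 'a \<Rightarrow> nat list \<Rightarrow>\<^sub>0 'a"
  have B: "word_prod S (\<lambda>i. Poly_Mapping.single [i] 1) ` lists {..<n} = ?m ` lists {..<n}"
    by (rule image_cong) (simp_all add: word_prod_S)
  have inj: "inj_on ?m U" for U :: "nat list set"
    by (rule inj_onI) (rule single_one_inj)
  have sum: "(\<Oplus>\<^bsub>S\<^esub>b\<in>?m ` U. b \<otimes>\<^bsub>S\<^esub> ?\<iota> (c b)) = (\<Sum>w\<in>U. Poly_Mapping.single w (c (?m w)))"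
    if "U \<subseteq> lists {..<n}" for U c
  proof -
    have U: "Poly_Mapping.single w s \<in> C" if "w \<in> U" for w s
      using \<open>U \<subseteq> lists {..<n}\<close> that C_single by blast
    have "(\<Oplus>\<^bsub>S\<^esub>b\<in>?m ` U. b \<otimes>\<^bsub>S\<^esub> ?\<iota> (c b)) = (\<Sum>b\<in>?m ` U. M b (?\<iota> (c b)))"
      using U by (subst finsum_S) (auto simp: S_simps M_single_const)
    also have "\<dots> = (\<Sum>w\<in>U. Poly_Mapping.single w (c (?m w)))"
      by (simp add: sum.reindex[OF inj] M_single_const)
    finally show ?thesis .
  qed
  have "right_independent S ?\<iota> (?m ` lists {..<n})"
    unfolding right_independent_def
  proof (intro allI impI)
    fix X c
    assume X: "finite X" "X \<subseteq> ?m ` lists {..<n}"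
      and z: "(\<Oplus>\<^bsub>S\<^esub>b\<in>X. b \<otimes>\<^bsub>S\<^esub> ?\<iota> (c b)) = \<zero>\<^bsub>S\<^esub>"
    then obtain U where U: "U \<subseteq> lists {..<n}" "X = ?m ` U" by (meson subset_imageE)
    have fin: "finite U" using X U inj finite_imageD by blast
    have "c (?m w) = 0" if w: "w \<in> U" for w
    proof -
      have "Poly_Mapping.lookup (\<Sum>w\<in>U. Poly_Mapping.single w (c (?m w))) w = c (?m w)"
        using w fin by (simp add: lookup_sum lookup_single when_def)
      then show ?thesis using z sum[OF U(1), of c] U by (simp add: S_simps)
    qed
    then show "\<forall>b\<in>X. c b = 0" using U by auto
  qed
  moreover have "right_span S ?\<iota> (?m ` lists {..<n}) = C"
  proof (intro equalityI subsetI)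
    fix f assume "f \<in> right_span S ?\<iota> (?m ` lists {..<n})"
    then obtain X c where X: "finite X" "X \<subseteq> ?m ` lists {..<n}"
      and f: "f = (\<Oplus>\<^bsub>S\<^esub>b\<in>X. b \<otimes>\<^bsub>S\<^esub> ?\<iota> (c b))" by (auto simp: right_span_def)
    then obtain U where U: "U \<subseteq> lists {..<n}" "X = ?m ` U" by (meson subset_imageE)
    show "f \<in> C" unfolding f U(2) sum[OF U(1)] using U by (intro C_sum C_single) auto
  next
    fix f assume f: "f \<in> C"
    let ?c = "\<lambda>b. Poly_Mapping.lookup f (the_inv_into UNIV ?m b)"
    have k: "Poly_Mapping.keys f \<subseteq> lists {..<n}" using f by (simp add: C_def)
    have "(\<Oplus>\<^bsub>S\<^esub>b\<in>?m ` Poly_Mapping.keys f. b \<otimes>\<^bsub>S\<^esub> ?\<iota> (?c b)) = f"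
      unfolding sum[OF k] using pm_expand[of f] by (simp add: the_inv_into_f_f[OF inj])
    then show "f \<in> right_span S ?\<iota> (?m ` lists {..<n})"
      unfolding right_span_def using k by (intro CollectI exI[of _ "?m ` Poly_Mapping.keys f"] exI[of _ ?c]) auto
  qed
  ultimately show ?thesis
    unfolding right_basis_def B by (auto simp: S_simps intro!: C_single)
qed

theorem free_skew_extension_skew_ring:
  "free_skew_extension (skew_ring n \<sigma> \<delta>) n \<sigma> \<delta> (Poly_Mapping.single []) (\<lambda>i. Poly_Mapping.single [i] 1)"
proof (rule free_skew_extension.intro[OF ring_S free_skew_extension_axioms.intro])
  show "Poly_Mapping.single [] \<in> Ring.ring_hom class_ring S"
    by (rule ring_hom_memI) (auto simp: S_simps C_single M_single_const single_add)
  show "inj (Poly_Mapping.single [] :: 'a \<Rightarrow> nat list \<Rightarrow>\<^sub>0 'a)" by (rule inj_single)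
  show "(\<lambda>i. Poly_Mapping.single [i] 1) \<in> {..<n} \<rightarrow> carrier S"
    by (auto simp: S_simps intro!: C_single)
  show "inj_on (\<lambda>i. Poly_Mapping.single [i] (1::'a)) {..<n}"
    by (rule inj_onI) (drule single_one_inj, simp)
  show "inj_on (word_prod S (\<lambda>i. Poly_Mapping.single [i] 1)) (lists {..<n})"
    by (rule inj_onI) (metis word_prod_S single_one_inj)
  show "right_basis S (Poly_Mapping.single []) (word_prod S (\<lambda>i. Poly_Mapping.single [i] 1) ` lists {..<n})"
    by (rule basis_S)
next
  fix r j assume j: "j < n"
  have c: "Poly_Mapping.single [i] (1::'a) \<otimes>\<^bsub>S\<^esub> Poly_Mapping.single [] s = Poly_Mapping.single [i] s" for i s
    by (simp add: S_simps M_single_const)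
  have "(\<Oplus>\<^bsub>S\<^esub>i\<in>{..<n}. Poly_Mapping.single [i] (1::'a) \<otimes>\<^bsub>S\<^esub> Poly_Mapping.single [] (\<sigma> r $$ (i, j))) =
      (\<Sum>i<n. Poly_Mapping.single [i] (\<sigma> r $$ (i, j)))"
    unfolding c by (rule finsum_S) (auto intro!: C_single)
  then show "Poly_Mapping.single [] r \<otimes>\<^bsub>S\<^esub> Poly_Mapping.single [j] 1 =
      (\<Oplus>\<^bsub>S\<^esub>i\<in>{..<n}. Poly_Mapping.single [i] 1 \<otimes>\<^bsub>S\<^esub> Poly_Mapping.single [] (\<sigma> r $$ (i, j)))
      \<oplus>\<^bsub>S\<^esub> Poly_Mapping.single [] (\<delta> r $$ (0, j))"
    using j by (simp add: S_simps M_single A_single pre_single)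
qed

end

end

theory Submission
  imports Defs
begin

text \<open>
  For a word \<open>w\<close> of length \<open>r\<close>, moving \<open>a \<in> R\<close> past \<open>w\<close> gives \<open>a w = \<Sum>\<^sub>u u \<sigma>^(r)(a)\<^sub>u\<^sub>w\<close> plus terms of lower
  degree, the sum being over the words \<open>u\<close> of length \<open>r\<close>. If \<open>f\<close> and \<open>g\<close> have degrees \<open>p\<close> and \<open>q\<close>
  and \<open>u\<close> is a word of length \<open>p\<close>, then the coefficients of \<open>f g\<close> at the words \<open>u v\<close> with \<open>|v| = q\<close>
  form the column \<open>\<sigma>^(q)(f\<^sub>u) g\<^sub>t\<^sub>o\<^sub>p\<close>. Hence independence of the columns of all \<open>\<sigma>^(q)(a)\<close>, \<open>a \<noteq> 0\<close>, makes
  \<open>deg\<close> additive. Conversely, for \<open>\<delta> = 0\<close> there are no lower terms, so a dependency between the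
  columns of \<open>\<sigma>^(r)(a)\<close> is a zero divisor. All of this is computed in the explicit ring
  \<^const>\<open>skew_ring\<close> and carried to an arbitrary free skew extension by the evaluation isomorphism.
\<close>

section \<open>Word-indexed entries and megainjectivity\<close>

abbreviation words :: "nat \<Rightarrow> nat \<Rightarrow> nat list set" where
  "words n r \<equiv> {w \<in> lists {..<n}. length w = r}"

text \<open>The entry of \<open>\<sigma>^(r)(a)\<close> in row \<open>u\<close> and column \<open>w\<close>, where words of length \<open>r\<close> index the rows
  and columns; it is the coefficient of \<open>u\<close> in the top-degree part of \<open>a w\<close>.\<close>

fun word_entry :: "('a::zero \<Rightarrow> 'a mat) \<Rightarrow> nat list \<Rightarrow> nat list \<Rightarrow> 'a \<Rightarrow> 'a" where
  "word_entry \<sigma> [] [] a = a"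
| "word_entry \<sigma> (i # u) (j # w) a = word_entry \<sigma> u w (\<sigma> a $$ (i, j))"
| "word_entry \<sigma> _ _ a = 0"

lemma word_entry_length_neq: "length u \<noteq> length w \<Longrightarrow> word_entry \<sigma> u w a = 0"
  by (induction \<sigma> u w a rule: word_entry.induct) auto

text \<open>\<open>word_entry\<close> consumes first letters, whereas \<open>hom_power\<close>
  applies \<sigma> to the entries of the previous power, so its recursion splits off the last
  letter. This equation links the two.\<close>

lemma word_entry_snoc:
  "length u = length w \<Longrightarrow>
    word_entry \<sigma> (u @ [i]) (w @ [j]) a = \<sigma> (word_entry \<sigma> u w a) $$ (i, j)"
  by (induction \<sigma> u w a rule: word_entry.induct) auto

text \<open>The first letter is the most significant digit, because \<^const>\<open>hom_power\<close> applies \<open>\<sigma>\<close> last in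
  the innermost blocks.\<close>

definition word_index :: "nat \<Rightarrow> nat list \<Rightarrow> nat" where
  "word_index n = foldl (\<lambda>k i. k * n + i) 0"

lemma word_index_simps [simp]:
  "word_index n [] = 0"
  "word_index n (w @ [i]) = word_index n w * n + i"
  by (simp_all add: word_index_def)

lemma word_index_less: "w \<in> lists {..<n} \<Longrightarrow> word_index n w < n ^ length w"
proof (induction w rule: rev_induct)
  case (snoc i w)
  then have "word_index n w + 1 \<le> n ^ length w" and i: "i < n" by auto
  have "(word_index n w + 1) * n \<le> n ^ length w * n"
    using \<open>word_index n w + 1 \<le> n ^ length w\<close> by (rule mult_le_mono1)
  then show ?case using i by (simp add: algebra_simps)
qed simp

text \<open>Letters are below \<open>n\<close>, so remainder and quotient by \<open>n\<close> return
  the last letter and the index of the remaining word.\<close>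

lemma word_index_inj: "inj_on (word_index n) (words n r)"
proof (rule inj_onI)
  fix u w assume "u \<in> words n r" "w \<in> words n r" "word_index n u = word_index n w"
  then show "u = w"
  proof (induction u arbitrary: w r rule: rev_induct)
    case (snoc i u)
    then obtain j w' where w: "w = w' @ [j]" by (cases w rule: rev_cases) auto
    have lt: "i < n" "j < n" using snoc.prems w by auto
    have e: "word_index n u * n + i = word_index n w' * n + j" using snoc.prems w by simp
    have "i = j" using arg_cong[OF e, of "\<lambda>k. k mod n"] lt by simp
    moreover have "word_index n u = word_index n w'"
      using arg_cong[OF e, of "\<lambda>k. k div n"] lt by simp
    ultimately show ?case using snoc.IH[of "length u" w'] snoc.prems w by auto
  qed auto
qed

lemma word_index_bij: "bij_betw (word_index n) (words n r) {..<n ^ r}"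
proof -
  have fin: "card (words n r) = n ^ r"
    using card_lists_length_eq[of "{..<n}" r] by (simp add: lists_eq_set)
  have "word_index n ` words n r = {..<n ^ r}"
    proof (rule card_subset_eq)
    show "word_index n ` words n r \<subseteq> {..<n ^ r}"
      using word_index_less[of _ n] by blast
  qed (simp_all add: card_image[OF word_index_inj] fin)
  then show ?thesis using word_index_inj by (simp add: bij_betw_def)
qed

lemma word_index_surj: "k < n ^ r \<Longrightarrow> \<exists>w\<in>words n r. k = word_index n w"
  using bij_betw_imp_surj_on[OF word_index_bij[of n r]] by blast

lemma finite_words: "finite (words n r)"
  using word_index_bij[of n r] bij_betw_finite by blast

section \<open>Matrix powers of \<sigma> indexed by words\<close>

lemma hom_power_carrier:
  assumes "\<And>a. \<sigma> a \<in> carrier_mat n n"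
  shows "hom_power n \<sigma> r a \<in> carrier_mat (n ^ r) (n ^ r)"
  using assms by (cases "(n, \<sigma>, r, a)" rule: hom_power.cases) simp_all

text \<open>The quotient by \<open>n\<close> corresponds to deleting the last letter and the
  remainder to that letter, so \<open>word_entry_snoc\<close> is the induction step. At exponent 0
  the dummy matrix with a single entry matches the empty word.\<close>

lemma hom_power_word_index:
  "u \<in> words n r \<Longrightarrow> w \<in> words n r \<Longrightarrow>
    hom_power n \<sigma> r a $$ (word_index n u, word_index n w) = word_entry \<sigma> u w a"
proof (induction n \<sigma> r a arbitrary: u w rule: hom_power.induct)
  case (2 n \<sigma> a)
  then obtain i j where "u = [i]" "w = [j]"
    by (auto simp: length_Suc_conv)
  then show ?case by (simp add: word_index_def)
next
  case (3 n \<sigma> r a)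
  obtain u' i where u: "u = u' @ [i]" using "3.prems" by (cases u rule: rev_cases) auto
  obtain w' j where w: "w = w' @ [j]" using "3.prems" by (cases w rule: rev_cases) auto
  have lt: "i < n" "j < n" using "3.prems" u w by auto
  have IH: "hom_power n \<sigma> (Suc r) a $$ (word_index n u', word_index n w') = word_entry \<sigma> u' w' a"
    using "3.prems" u w by (intro "3.IH") auto
  have "word_index n u < n ^ Suc (Suc r)" "word_index n w < n ^ Suc (Suc r)"
    using "3.prems" word_index_less[of u n] word_index_less[of w n] by auto
  then show ?case
    using lt IH "3.prems" by (simp add: u w word_entry_snoc)
qed simp

text \<open>Reindexing the row-times-column sum by words turns a matrix equation into the sums of
  \<open>columns_independent\<close>.\<close>

lemma hom_power_mult_entry:
  assumes "\<And>a. \<sigma> a \<in> carrier_mat n n" and "B \<in> carrier_mat (n ^ r) (n ^ r)"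
    and "u \<in> words n r" and "k < n ^ r"
  shows "(hom_power n \<sigma> r a * B) $$ (word_index n u, k) =
    (\<Sum>w\<in>words n r. word_entry \<sigma> u w a * B $$ (word_index n w, k))"
proof -
  have "word_index n u < n ^ r" using assms(3) word_index_less[of u n] by auto
  moreover have "dim_row (hom_power n \<sigma> r a) = n ^ r" "dim_col (hom_power n \<sigma> r a) = n ^ r"
    using hom_power_carrier[of \<sigma> n r a, OF assms(1)] by auto
  ultimately have "(hom_power n \<sigma> r a * B) $$ (word_index n u, k) =
      (\<Sum>l<n ^ r. hom_power n \<sigma> r a $$ (word_index n u, l) * B $$ (l, k))"
    using assms by (simp add: scalar_prod_def atLeast0LessThan)
  also have "\<dots> = (\<Sum>w\<in>words n r. hom_power n \<sigma> r a $$ (word_index n u, word_index n w) * B $$ (word_index n w, k))"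
    by (rule sum.reindex_bij_betw[OF word_index_bij, symmetric])
  also have "\<dots> = (\<Sum>w\<in>words n r. word_entry \<sigma> u w a * B $$ (word_index n w, k))"
    using assms(3) by (intro sum.cong refl) (simp add: hom_power_word_index)
  finally show ?thesis .
qed

text \<open>\<open>r = 0\<close> says that \<open>R\<close> has no zero divisors.\<close>

definition columns_independent :: "nat \<Rightarrow> ('a::ring_1 \<Rightarrow> 'a mat) \<Rightarrow> bool" where
  "columns_independent n \<sigma> \<longleftrightarrow>
     (\<forall>r a v. a \<noteq> 0 \<longrightarrow> (\<forall>u\<in>words n r. (\<Sum>w\<in>words n r. word_entry \<sigma> u w a * v w) = 0) \<longrightarrow>
        (\<forall>w\<in>words n r. v w = 0))"

lemma columns_independentD:
  assumes "columns_independent n \<sigma>" "a \<noteq> 0"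
    and "\<forall>u\<in>words n r. (\<Sum>w\<in>words n r. word_entry \<sigma> u w a * v w) = 0" and "w \<in> words n r"
  shows "v w = 0"
  using assms(1)[unfolded columns_independent_def, THEN spec[of _ r], THEN spec[of _ a], THEN spec[of _ v],
      THEN mp, OF assms(2), THEN mp, OF assms(3)] assms(4) by (rule bspec)

section \<open>Megainjectivity as independence of columns\<close>

lemma megainjectiveD:
  assumes "megainjective n \<sigma>" "a \<noteq> 0" "r \<ge> 1"
  shows "hom_power n \<sigma> r a \<noteq> 0\<^sub>m (n ^ r) (n ^ r)"
    and "\<not> left_zero_divisor_mat (n ^ r) (hom_power n \<sigma> r a)"
  using assms unfolding megainjective_def by blast+

text \<open>Left zero divisors are tested against square matrices, so the vector \<open>v\<close> is
  repeated in every column of a square matrix \<open>B\<close>. The empty word needs its own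
  argument, because megainjectivity starts at exponent 1.\<close>

lemma megainjective_imp_columns_independent:
  assumes hom: "\<sigma> \<in> Ring.ring_hom class_ring (ring_mat TYPE('a::ring_1) n ())"
    and n: "n \<ge> 1" and meg: "megainjective n \<sigma>"
  shows "columns_independent n \<sigma>"
  unfolding columns_independent_def
proof (intro allI impI)
  fix r a and v :: "nat list \<Rightarrow> 'a"
  assume a: "a \<noteq> 0" and z: "\<forall>u\<in>words n r. (\<Sum>w\<in>words n r. word_entry \<sigma> u w a * v w) = 0"
  have car: "\<sigma> b \<in> carrier_mat n n" for b
    using hom by (auto simp: Ring.ring_hom_def ring_mat_simps)
  show "\<forall>w\<in>words n r. v w = 0"
  proof (cases "r = 0")
    case True
    then have w0: "words n r = {[]}" by auto
    \<comment> \<open>Applying \<sigma> moves this equation to matrices. Megainjectivity at exponent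
      1 cancels \<open>\<sigma> a\<close> and then shows that only 0 has the zero matrix as
      image.\<close>
    have "a * v [] = 0" using z unfolding w0 by simp
    moreover have "\<sigma> (a * v []) = \<sigma> a * \<sigma> (v [])"
      using ring_hom_mult[OF hom, of a "v []"] by (simp add: ring_mat_simps)
    ultimately have "\<sigma> a * \<sigma> (v []) = \<sigma> 0" by simp
    moreover have "\<sigma> 0 = 0\<^sub>m n n"
    proof -
      have "\<sigma> (0 + 0) = \<sigma> 0 + \<sigma> 0"
        using ring_hom_add[OF hom, of 0 0] by (simp add: ring_mat_simps)
      then have e: "\<sigma> 0 = \<sigma> 0 + \<sigma> 0" by simp
      show ?thesis
      proof (rule eq_matI)
        fix i j assume "i < dim_row (0\<^sub>m n n :: 'a mat)" "j < dim_col (0\<^sub>m n n :: 'a mat)"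
        then show "\<sigma> 0 $$ (i, j) = 0\<^sub>m n n $$ (i, j)"
          using arg_cong[OF e, of "\<lambda>A. A $$ (i, j)"] car[of 0] by auto
      qed (use car[of 0] in auto)
    qed
    ultimately have "\<sigma> a * \<sigma> (v []) = 0\<^sub>m n n" by simp
    moreover have "\<not> left_zero_divisor_mat n (\<sigma> a)"
      using megainjectiveD(2)[OF meg a, of 1] by simp
    ultimately have "\<sigma> (v []) = 0\<^sub>m n n"
      using car[of "v []"] unfolding left_zero_divisor_mat_def by blast
    then have "v [] = 0"
      using megainjectiveD(1)[OF meg, of "v []" 1] by auto
    then show ?thesis unfolding w0 by simp
  next
    case False
    let ?N = "n ^ r"
    define B where "B = mat ?N ?N (\<lambda>(i, k). v (the_inv_into (words n r) (word_index n) i))"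
    have Bc: "B \<in> carrier_mat ?N ?N" by (simp add: B_def)
    have Bv: "B $$ (word_index n w, k) = v w" if "w \<in> words n r" "k < ?N" for w k
      using that word_index_less[of w n]
      by (auto simp: B_def the_inv_into_f_f[OF word_index_inj])
    have "hom_power n \<sigma> r a * B = 0\<^sub>m ?N ?N"
    proof (rule eq_matI)
      fix i k assume "i < dim_row (0\<^sub>m ?N ?N :: 'a mat)" "k < dim_col (0\<^sub>m ?N ?N :: 'a mat)"
      then have ik: "i < ?N" "k < ?N" by auto
      then obtain u where u: "u \<in> words n r" "i = word_index n u"
        using word_index_surj[OF ik(1)] by blast
      have "(hom_power n \<sigma> r a * B) $$ (i, k) = (\<Sum>w\<in>words n r. word_entry \<sigma> u w a * v w)"
        unfolding u(2) hom_power_mult_entry[OF car Bc u(1) ik(2)]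
        using ik(2) by (intro sum.cong refl) (simp add: Bv)
      also have "\<dots> = 0" using z u(1) by blast
      finally show "(hom_power n \<sigma> r a * B) $$ (i, k) = 0\<^sub>m ?N ?N $$ (i, k)" using ik by simp
    qed (use hom_power_carrier[of \<sigma> n r a, OF car] Bc in auto)
    moreover have "\<not> left_zero_divisor_mat ?N (hom_power n \<sigma> r a)"
      using megainjectiveD(2)[OF meg a] False by simp
    ultimately have "B = 0\<^sub>m ?N ?N" using Bc unfolding left_zero_divisor_mat_def by blast
    \<comment> \<open>Any column of \<open>B\<close> returns \<open>v\<close>; column 0 exists
      because \<open>n \<ge> 1\<close> makes \<open>n ^ r\<close> positive.\<close>
    then show ?thesis
      using Bv[of _ 0] n word_index_less by fastforce
  qed
qed

text \<open>Each column of a matrix \<open>B\<close> annihilated from the left by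
  \<open>hom_power n \<sigma> r a\<close> is a relation between the columns of the latter, hence
  zero.\<close>

lemma columns_independent_imp_megainjective:
  assumes hom: "\<sigma> \<in> Ring.ring_hom class_ring (ring_mat TYPE('a::ring_1) n ())"
    and n: "n \<ge> 1" and ind: "columns_independent n \<sigma>"
  shows "megainjective n \<sigma>"
  unfolding megainjective_def
proof (intro allI impI)
  fix a :: 'a and r assume a: "a \<noteq> 0" and "r \<ge> (1::nat)"
  let ?N = "n ^ r" and ?H = "hom_power n \<sigma> r a"
  have car: "\<sigma> b \<in> carrier_mat n n" for b
    using hom by (auto simp: Ring.ring_hom_def ring_mat_simps)
  have nz: "\<not> left_zero_divisor_mat ?N ?H"
  proof
    assume "left_zero_divisor_mat ?N ?H"
    then obtain B where B: "B \<in> carrier_mat ?N ?N" "B \<noteq> 0\<^sub>m ?N ?N" "?H * B = 0\<^sub>m ?N ?N"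
      unfolding left_zero_divisor_mat_def by blast
    have "B $$ (i, k) = 0" if ik: "i < ?N" "k < ?N" for i k
    proof -
      obtain w where w: "w \<in> words n r" "i = word_index n w"
        using word_index_surj[OF ik(1)] by blast
      have "\<forall>u\<in>words n r. (\<Sum>w\<in>words n r. word_entry \<sigma> u w a * B $$ (word_index n w, k)) = 0"
      proof
        fix u assume u: "u \<in> words n r"
        have "word_index n u < ?N" using u word_index_less[of u n] by auto
        then have "(?H * B) $$ (word_index n u, k) = 0" using ik(2) unfolding B(3) by simp
        then show "(\<Sum>w\<in>words n r. word_entry \<sigma> u w a * B $$ (word_index n w, k)) = 0"
          unfolding hom_power_mult_entry[where \<sigma> = \<sigma> and a = a, OF car B(1) u ik(2)] .
      qed
      then show ?thesis
        unfolding w(2) by (rule columns_independentD[OF ind a _ w(1), of "\<lambda>w. B $$ (word_index n w, k)"])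
    qed
    then have "B = 0\<^sub>m ?N ?N" using B(1) by (intro eq_matI) auto
    then show False using B(2) by simp
  qed
  \<comment> \<open>Otherwise the identity matrix would witness a left zero divisor; it is nonzero
    because \<open>1 \<noteq> 0\<close> in R and \<open>n \<ge> 1\<close> gives it an entry.\<close>
  moreover have "?H \<noteq> 0\<^sub>m ?N ?N"
  proof
    assume H: "?H = 0\<^sub>m ?N ?N"
    have "(1\<^sub>m ?N :: 'a mat) $$ (0, 0) \<noteq> (0\<^sub>m ?N ?N :: 'a mat) $$ (0, 0)" using n by simp
    then have "(1\<^sub>m ?N :: 'a mat) \<noteq> 0\<^sub>m ?N ?N" by metis
    then show False using nz H unfolding left_zero_divisor_mat_def by (metis left_mult_zero_mat one_carrier_mat)
  qed
  ultimately show "?H \<noteq> 0\<^sub>m ?N ?N \<and> \<not> left_zero_divisor_mat ?N ?H" by simp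
qed

section \<open>Leading coefficients of products\<close>

abbreviation skew_carrier :: "nat \<Rightarrow> (nat list \<Rightarrow>\<^sub>0 'a::ring_1) set" where
  "skew_carrier n \<equiv> {f. Poly_Mapping.keys f \<subseteq> lists {..<n}}"

text \<open>Both sides are additive in \<open>f\<close>, so single terms suffice, and there the
  operation just prepends \<open>u\<close> to the word.\<close>

lemma lookup_foldr_skew_pre:
  "Poly_Mapping.lookup (foldr skew_pre u f) v =
    (if take (length u) v = u then Poly_Mapping.lookup f (drop (length u) v) else 0)"
proof (rule add_eqI[of "\<lambda>f. Poly_Mapping.lookup (foldr skew_pre u f) v"])
  show "is_additive (\<lambda>f. Poly_Mapping.lookup (foldr skew_pre u f) v)"
    by (simp add: is_additive_def lookup_add is_additiveD[OF foldr_pre_add])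
  fix w and r :: 'a
  have "u @ w = v \<longleftrightarrow> take (length u) v = u \<and> w = drop (length u) v"
    using append_eq_conv_conj[of u w v] by metis
  then show "Poly_Mapping.lookup (foldr skew_pre u (Poly_Mapping.single w r)) v =
    (if take (length u) v = u then Poly_Mapping.lookup (Poly_Mapping.single w r) (drop (length u) v) else 0)"
    by (auto simp: foldr_pre_single lookup_single when_def)
qed (simp add: is_additive_def lookup_add)

lemma lookup_skew_pre_Nil [simp]: "Poly_Mapping.lookup (skew_pre i f) [] = 0"
  using lookup_foldr_skew_pre[of "[i]" f "[]"] by simp

lemma lookup_skew_pre_Cons [simp]:
  "Poly_Mapping.lookup (skew_pre i f) (k # v) = (if k = i then Poly_Mapping.lookup f v else 0)"
  using lookup_foldr_skew_pre[of "[i]" f "k # v"] by simp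

text \<open>The data of the explicit ring alone: its coefficient formulas need no abstract
  extension, and \<open>columns_independentI\<close> uses them in that ring directly.\<close>

locale skew_data =
  fixes n :: nat and \<sigma> \<delta> :: "'a::ring_1 \<Rightarrow> 'a mat"
  assumes hom: "\<sigma> \<in> Ring.ring_hom class_ring (ring_mat TYPE('a) n ())"
    and der: "right_derivation n \<sigma> \<delta>"
begin

lemma skew_carrier_add: "f \<in> skew_carrier n \<Longrightarrow> g \<in> skew_carrier n \<Longrightarrow> f + g \<in> skew_carrier n"
  using keys_add[of f g] by blast

lemma skew_carrier_sum:
  "(\<And>i. i \<in> I \<Longrightarrow> f i \<in> skew_carrier n) \<Longrightarrow> sum f I \<in> skew_carrier n"
proof (induction I rule: infinite_finite_induct)
  case (insert i I)
  then show ?case using skew_carrier_add[of "f i" "sum f I"] by simp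
qed simp_all

lemma skew_carrier_single: "w \<in> lists {..<n} \<Longrightarrow> Poly_Mapping.single w r \<in> skew_carrier n"
  by simp

text \<open>The closure lemmas for the explicit ring name this set by a constant private to their
  context; the carrier of \<open>skew_ring\<close> is the link to it.\<close>

lemma skew_carrier_eq: "skew_carrier n = carrier (skew_ring n \<sigma> \<delta>)"
  by (simp add: skew_ring_def)

lemma skew_carrier_pre:
  "i < n \<Longrightarrow> (f :: nat list \<Rightarrow>\<^sub>0 'a) \<in> skew_carrier n \<Longrightarrow> skew_pre i f \<in> skew_carrier n"
  unfolding skew_carrier_eq S_simps(1)[OF hom der] by (rule C_pre[OF hom der])

lemma skew_carrier_foldr_pre:
  "u \<in> lists {..<n} \<Longrightarrow> (f :: nat list \<Rightarrow>\<^sub>0 'a) \<in> skew_carrier n \<Longrightarrow> foldr skew_pre u f \<in> skew_carrier n"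
  unfolding skew_carrier_eq S_simps(1)[OF hom der] by (rule C_foldr_pre[OF hom der])

lemma skew_carrier_act: "f \<in> skew_carrier n \<Longrightarrow> skew_act n \<sigma> \<delta> r f \<in> skew_carrier n"
  unfolding skew_carrier_eq S_simps(1)[OF hom der] by (rule C_A[OF hom der])

lemma skew_carrier_mult:
  "f \<in> skew_carrier n \<Longrightarrow> g \<in> skew_carrier n \<Longrightarrow> skew_mult n \<sigma> \<delta> f g \<in> skew_carrier n"
  unfolding skew_carrier_eq S_simps(1)[OF hom der] by (rule C_M[OF hom der])

text \<open>\<open>evaluate\<close> will be shown additive only on the carrier, so this principle
  keeps the carrier membership of both summands, whereas \<open>add_eqI\<close> asks for additivity
  everywhere.\<close>

lemma skew_carrier_induct [consumes 1, case_names single add]: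
  assumes f: "f \<in> skew_carrier n"
    and single: "\<And>w r. w \<in> lists {..<n} \<Longrightarrow> P (Poly_Mapping.single w r)"
    and add: "\<And>f g. f \<in> skew_carrier n \<Longrightarrow> g \<in> skew_carrier n \<Longrightarrow> P f \<Longrightarrow> P g \<Longrightarrow> P (f + g)"
  shows "P f"
proof -
  let ?s = "\<lambda>w. Poly_Mapping.single w (Poly_Mapping.lookup f w)"
  have "P (sum ?s U) \<and> sum ?s U \<in> skew_carrier n" if "finite U" "U \<subseteq> lists {..<n}" for U
    using that
  proof (induction U rule: finite_induct)
    case empty
    \<comment> \<open>The zero element is a term with coefficient 0.\<close>
    then show ?case using single[of "[]" 0] by simp
  next
    case (insert w U)
    then have w: "w \<in> lists {..<n}" and IH: "P (sum ?s U)" "sum ?s U \<in> skew_carrier n" by auto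
    have "P (?s w + sum ?s U)"
      by (rule add[OF skew_carrier_single[OF w] IH(2) single[OF w] IH(1)])
    moreover have "?s w + sum ?s U \<in> skew_carrier n"
      by (rule skew_carrier_add[OF skew_carrier_single[OF w] IH(2)])
    ultimately show ?case using insert.hyps by simp
  qed
  from this[of "Poly_Mapping.keys f"] have "P (sum ?s (Poly_Mapping.keys f))" using f by simp
  then show ?thesis by (subst pm_expand)
qed

text \<open>Each commutation either exchanges a letter via \<sigma>, keeping the length, or drops it
  via \<delta>. Hence \<delta> affects only words shorter than \<open>w\<close>, and if \<delta> is
  zero the formula holds at all words.\<close>

lemma lookup_skew_act_word:
  assumes "w \<in> lists {..<n}" "u \<in> lists {..<n}"
    and "length w \<le> length u \<or> \<delta> = zero_derivation n"
  shows "Poly_Mapping.lookup (skew_act_word n \<sigma> \<delta> w a s) u = word_entry \<sigma> u w a * s"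
  using assms
proof (induction w arbitrary: u a rule: list.induct)
  case Nil
  then show ?case by (cases u) (auto simp: lookup_single)
next
  case (Cons j w)
  have j: "j < n" and w: "w \<in> lists {..<n}" using Cons.prems(1) by simp_all
  have "skew_act_word n \<sigma> \<delta> w 0 s = 0"
    using A_zero[OF hom der] A_single[OF hom der] by metis
  \<comment> \<open>If \<open>u\<close> is too short, the third hypothesis leaves only zero
    \<delta>, and the scalar 0 acts as 0.\<close>
  then have d: "Poly_Mapping.lookup (skew_act_word n \<sigma> \<delta> w (\<delta> a $$ (0, j)) s) u = 0"
    if "\<not> length (j # w) \<le> length u"
    using that Cons.prems(3) j by (auto simp: zero_derivation_def)
  show ?case
  proof (cases u)
    case Nil
    then show ?thesis using j d by (simp add: lookup_add lookup_sum)
  next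
    case u: (Cons k v)
    then have k: "k < n" and v: "v \<in> lists {..<n}" using Cons.prems(2) by simp_all
    have e1: "Poly_Mapping.lookup (skew_act_word n \<sigma> \<delta> w (\<delta> a $$ (0, j)) s) u = 0"
    proof (cases "length (j # w) \<le> length u")
      case True
      \<comment> \<open>The letter \<open>j\<close> has been dropped, so \<open>w\<close> is
        strictly shorter than \<open>u\<close> and the entry vanishes.\<close>
      then have "length u \<noteq> length w" "length w \<le> length u" by simp_all
      then show ?thesis
        using Cons.IH[OF w Cons.prems(2), of "\<delta> a $$ (0, j)"] by (simp add: word_entry_length_neq)
    qed (rule d)
    have e2: "Poly_Mapping.lookup (\<Sum>i<n. skew_pre i (skew_act_word n \<sigma> \<delta> w (\<sigma> a $$ (i, j)) s)) u
        = Poly_Mapping.lookup (skew_act_word n \<sigma> \<delta> w (\<sigma> a $$ (k, j)) s) v"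
      using k by (simp add: u lookup_sum if_distrib cong: if_cong)
    have e3: "\<dots> = word_entry \<sigma> v w (\<sigma> a $$ (k, j)) * s"
      using Cons.prems(3) u by (intro Cons.IH w v) auto
    have "skew_act_word n \<sigma> \<delta> (j # w) a s =
        (\<Sum>i<n. skew_pre i (skew_act_word n \<sigma> \<delta> w (\<sigma> a $$ (i, j)) s))
          + skew_act_word n \<sigma> \<delta> w (\<delta> a $$ (0, j)) s"
      using j by simp
    moreover have "word_entry \<sigma> u (j # w) a = word_entry \<sigma> v w (\<sigma> a $$ (k, j))"
      by (simp only: u word_entry.simps)
    ultimately show ?thesis by (simp only: lookup_add e1 e2 e3 add_0_right)
  qed
qed

text \<open>This is a row of a matrix times the coefficient column of \<open>f\<close>: entries for
  words of unequal length are 0, and so are coefficients outside the support.\<close>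

lemma lookup_skew_act:
  assumes "f \<in> skew_carrier n" "u \<in> lists {..<n}"
    and "(\<forall>w\<in>Poly_Mapping.keys f. length w \<le> length u) \<or> \<delta> = zero_derivation n"
  shows "Poly_Mapping.lookup (skew_act n \<sigma> \<delta> a f) u =
    (\<Sum>w\<in>words n (length u). word_entry \<sigma> u w a * Poly_Mapping.lookup f w)"
proof -
  have "Poly_Mapping.lookup (skew_act n \<sigma> \<delta> a f) u =
      (\<Sum>w\<in>Poly_Mapping.keys f. word_entry \<sigma> u w a * Poly_Mapping.lookup f w)"
    unfolding skew_act_def lookup_sum
    using assms by (intro sum.cong refl lookup_skew_act_word) auto
  also have "\<dots> = (\<Sum>w\<in>Poly_Mapping.keys f \<inter> words n (length u). word_entry \<sigma> u w a * Poly_Mapping.lookup f w)"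
  proof (rule sum.mono_neutral_right)
    show "\<forall>w\<in>Poly_Mapping.keys f - Poly_Mapping.keys f \<inter> words n (length u).
        word_entry \<sigma> u w a * Poly_Mapping.lookup f w = 0"
    proof
      fix w assume "w \<in> Poly_Mapping.keys f - Poly_Mapping.keys f \<inter> words n (length u)"
      then have "length u \<noteq> length w" using assms(1) by auto
      then show "word_entry \<sigma> u w a * Poly_Mapping.lookup f w = 0" by (simp add: word_entry_length_neq)
    qed
  qed auto
  also have "\<dots> = (\<Sum>w\<in>words n (length u). word_entry \<sigma> u w a * Poly_Mapping.lookup f w)"
    using finite_words[of n "length u"] by (intro sum.mono_neutral_left) (auto simp: in_keys_iff)
  finally show ?thesis .
qed

lemma lookup_skew_mult:
  "Poly_Mapping.lookup (skew_mult n \<sigma> \<delta> f g) v =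
    (\<Sum>u\<in>Poly_Mapping.keys f. if take (length u) v = u
      then Poly_Mapping.lookup (skew_act n \<sigma> \<delta> (Poly_Mapping.lookup f u) g) (drop (length u) v) else 0)"
  unfolding skew_mult_def lookup_sum lookup_foldr_skew_pre ..

text \<open>Moving a scalar past words never lengthens them: the formula for the action reads
  \<open>g\<close> only at words as long as \<open>u\<close>, where \<open>g\<close>
  vanishes.\<close>

lemma lookup_skew_act_above:
  assumes "g \<in> skew_carrier n" "u \<in> lists {..<n}" "\<forall>w\<in>Poly_Mapping.keys g. length w < length u"
  shows "Poly_Mapping.lookup (skew_act n \<sigma> \<delta> a g) u = 0"
proof -
  have "Poly_Mapping.lookup (skew_act n \<sigma> \<delta> a g) u =
      (\<Sum>w\<in>words n (length u). word_entry \<sigma> u w a * Poly_Mapping.lookup g w)"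
    using assms by (intro lookup_skew_act) (auto intro: less_imp_le)
  also have "\<dots> = 0"
  proof (rule sum.neutral, rule ballI)
    fix w assume "w \<in> words n (length u)"
    then have "w \<notin> Poly_Mapping.keys g" using assms(3) by auto
    then show "word_entry \<sigma> u w a * Poly_Mapping.lookup g w = 0" by (simp add: in_keys_iff)
  qed
  finally show ?thesis .
qed

text \<open>A prefix taken from \<open>f\<close> has length at most \<open>p\<close> and leaves a
  suffix longer than \<open>q\<close>, which the action on \<open>g\<close> cannot reach.\<close>

lemma lookup_skew_mult_above:
  assumes "f \<in> skew_carrier n" "g \<in> skew_carrier n" "v \<in> lists {..<n}"
    and "\<forall>w\<in>Poly_Mapping.keys f. length w \<le> p" "\<forall>w\<in>Poly_Mapping.keys g. length w \<le> q"
    and "p + q < length v"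
  shows "Poly_Mapping.lookup (skew_mult n \<sigma> \<delta> f g) v = 0"
  unfolding lookup_skew_mult
proof (rule sum.neutral, rule ballI)
  fix u assume "u \<in> Poly_Mapping.keys f"
  then have l: "length u \<le> p" using assms(4) by blast
  have "drop (length u) v \<in> lists {..<n}"
    using assms(3) set_drop_subset[of "length u" v] by (auto simp: in_lists_conv_set)
  then have "Poly_Mapping.lookup (skew_act n \<sigma> \<delta> (Poly_Mapping.lookup f u) g) (drop (length u) v) = 0"
  proof (rule lookup_skew_act_above[OF assms(2)], intro ballI)
    fix w assume "w \<in> Poly_Mapping.keys g"
    then have "length w \<le> q" using assms(5) by blast
    then show "length w < length (drop (length u) v)" using l assms(6) by simp
  qed
  then show "(if take (length u) v = u
      then Poly_Mapping.lookup (skew_act n \<sigma> \<delta> (Poly_Mapping.lookup f u) g) (drop (length u) v) else 0) = 0"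
    by simp
qed

text \<open>Only the prefix of length \<open>p\<close> matters, since shorter prefixes leave a
  suffix longer than \<open>q\<close>. Its coefficient then acts on the top part of
  \<open>g\<close>.\<close>

lemma lookup_skew_mult_top:
  assumes "f \<in> skew_carrier n" "g \<in> skew_carrier n" "u \<in> words n p" "v \<in> words n q"
    and "\<forall>w\<in>Poly_Mapping.keys f. length w \<le> p" "\<forall>w\<in>Poly_Mapping.keys g. length w \<le> q"
  shows "Poly_Mapping.lookup (skew_mult n \<sigma> \<delta> f g) (u @ v) =
    (\<Sum>w\<in>words n q. word_entry \<sigma> v w (Poly_Mapping.lookup f u) * Poly_Mapping.lookup g w)"
proof -
  let ?h = "\<lambda>u'. if take (length u') (u @ v) = u'
    then Poly_Mapping.lookup (skew_act n \<sigma> \<delta> (Poly_Mapping.lookup f u') g) (drop (length u') (u @ v)) else 0"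
  have z: "?h u' = 0" if u': "u' \<in> Poly_Mapping.keys f" "u' \<noteq> u" for u'
  proof (cases "length u' = length u")
    case True
    then show ?thesis using u' by auto
  next
    case False
    moreover have "length u' \<le> p" using assms(5) u'(1) by blast
    ultimately have l: "length u' < p" using assms(3) by simp
    have "drop (length u') (u @ v) \<in> lists {..<n}"
      using assms(3,4) set_drop_subset[of "length u'" "u @ v"] by (auto simp: in_lists_conv_set)
    then have "Poly_Mapping.lookup (skew_act n \<sigma> \<delta> (Poly_Mapping.lookup f u') g) (drop (length u') (u @ v)) = 0"
    proof (rule lookup_skew_act_above[OF assms(2)], intro ballI)
      fix w assume "w \<in> Poly_Mapping.keys g"
      then have "length w \<le> q" using assms(6) by blast
      then show "length w < length (drop (length u') (u @ v))" using l assms(3,4) by simp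
    qed
    then show ?thesis by simp
  qed
  \<comment> \<open>The word \<open>u\<close> may be missing from the support of \<open>f\<close>;
    its coefficient 0 then acts as 0, so the formula still holds.\<close>
  have act0: "skew_act n \<sigma> \<delta> 0 g = 0" by (rule A_zero[OF hom der])
  have "(\<Sum>u'\<in>Poly_Mapping.keys f. ?h u') = ?h u"
  proof (cases "u \<in> Poly_Mapping.keys f")
    case True
    then show ?thesis using z by (subst sum.remove[of _ u]) (auto intro!: sum.neutral)
  next
    case False
    then have "?h u = 0" using act0 by (simp add: in_keys_iff)
    moreover have "(\<Sum>u'\<in>Poly_Mapping.keys f. ?h u') = 0"
      using z False by (intro sum.neutral) blast
    ultimately show ?thesis by simp
  qed
  also have "?h u = Poly_Mapping.lookup (skew_act n \<sigma> \<delta> (Poly_Mapping.lookup f u) g) v" by simp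
  also have "\<dots> = (\<Sum>w\<in>words n q. word_entry \<sigma> v w (Poly_Mapping.lookup f u) * Poly_Mapping.lookup g w)"
    using assms lookup_skew_act[of g v] by auto
  finally show ?thesis by (simp add: lookup_skew_mult)
qed

end

text \<open>The value at \<open>0\<close> is junk.\<close>

definition word_deg :: "(nat list \<Rightarrow>\<^sub>0 'a::ring_1) \<Rightarrow> nat" where
  "word_deg f = Max (length ` Poly_Mapping.keys f)"

section \<open>Degree as maximal word length\<close>

lemma word_deg_ge: "w \<in> Poly_Mapping.keys f \<Longrightarrow> length w \<le> word_deg f"
  by (simp add: word_deg_def)

lemma word_deg_attained:
  assumes "f \<noteq> 0"
  shows "\<exists>w\<in>Poly_Mapping.keys f. length w = word_deg f"
proof -
  have "word_deg f \<in> length ` Poly_Mapping.keys f"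
    unfolding word_deg_def using assms by (intro Max_in) auto
  then show ?thesis by auto
qed

lemma word_deg_eqI:
  "w \<in> Poly_Mapping.keys f \<Longrightarrow> (\<And>u. u \<in> Poly_Mapping.keys f \<Longrightarrow> length u \<le> length w) \<Longrightarrow>
    word_deg f = length w"
  unfolding word_deg_def by (intro Max_eqI) auto

lemma word_deg_diff:
  assumes "f - g \<noteq> 0" "f \<noteq> 0" "g \<noteq> 0"
  shows "word_deg (f - g) \<le> max (word_deg f) (word_deg g)"
proof -
  obtain w where w: "w \<in> Poly_Mapping.keys (f - g)" "length w = word_deg (f - g)"
    using word_deg_attained[OF assms(1)] by blast
  then have "w \<in> Poly_Mapping.keys f \<or> w \<in> Poly_Mapping.keys g" using keys_diff[of f g] by blast
  then show ?thesis using w(2) word_deg_ge[of w f] word_deg_ge[of w g] by auto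
qed

lemma word_deg_uminus: "word_deg (- f) = word_deg f"
  by (simp add: word_deg_def)

text \<open>For a longest word \<open>u\<close> of \<open>f\<close>, independence of columns
  prevents the matrix of its nonzero coefficient from annihilating the top coefficients of
  \<open>g\<close>. So the product contains a word \<open>u @ v\<close> of the largest possible
  length.\<close>

lemma (in skew_data) word_deg_skew_mult:
  assumes ind: "columns_independent n \<sigma>"
    and f: "f \<in> skew_carrier n" "f \<noteq> 0" and g: "g \<in> skew_carrier n" "g \<noteq> 0"
  shows "skew_mult n \<sigma> \<delta> f g \<noteq> 0"
    and "word_deg (skew_mult n \<sigma> \<delta> f g) = word_deg f + word_deg g"
proof -
  let ?p = "word_deg f" and ?q = "word_deg g" and ?m = "skew_mult n \<sigma> \<delta> f g"
  obtain u where u: "u \<in> Poly_Mapping.keys f" "length u = ?p" using word_deg_attained[OF f(2)] by blast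
  obtain w where w: "w \<in> Poly_Mapping.keys g" "length w = ?q" using word_deg_attained[OF g(2)] by blast
  have fu: "Poly_Mapping.lookup f u \<noteq> 0" and gw: "Poly_Mapping.lookup g w \<noteq> 0"
    using u w by (simp_all add: in_keys_iff)
  have U: "u \<in> words n ?p" and W: "w \<in> words n ?q" using u w f g by auto
  have "\<not> (\<forall>v\<in>words n ?q. (\<Sum>w\<in>words n ?q. word_entry \<sigma> v w (Poly_Mapping.lookup f u) * Poly_Mapping.lookup g w) = 0)"
    using columns_independentD[OF ind fu _ W, of "Poly_Mapping.lookup g"] gw by argo
  then obtain v where v: "v \<in> words n ?q"
    "(\<Sum>w\<in>words n ?q. word_entry \<sigma> v w (Poly_Mapping.lookup f u) * Poly_Mapping.lookup g w) \<noteq> 0" by blast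
  have "Poly_Mapping.lookup ?m (u @ v) \<noteq> 0"
    using v(2) by (subst lookup_skew_mult_top[OF f(1) g(1) U v(1)]) (simp_all add: word_deg_ge)
  then have k: "u @ v \<in> Poly_Mapping.keys ?m" by (simp add: in_keys_iff)
  then show "?m \<noteq> 0" by auto
  have c: "Poly_Mapping.keys ?m \<subseteq> lists {..<n}"
    using skew_carrier_mult[OF f(1) g(1)] by simp
  have "word_deg ?m = length (u @ v)"
  proof (rule word_deg_eqI[OF k], rule ccontr)
    fix z assume z: "z \<in> Poly_Mapping.keys ?m" "\<not> length z \<le> length (u @ v)"
    then have "Poly_Mapping.lookup ?m z = 0"
      using lookup_skew_mult_above[OF f(1) g(1), of z ?p ?q] c u(2) v(1) by (auto simp: word_deg_ge)
    then show False using z(1) by (simp add: in_keys_iff)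
  qed
  then show "word_deg ?m = ?p + ?q" using u(2) v(1) by simp
qed

text \<open>A dependency between the columns of \<open>\<sigma>^(r)(a)\<close> is the coefficient family of a homogeneous
  element \<open>g\<close> of degree \<open>r\<close> with \<open>a g = 0\<close>, since no lower terms arise for \<open>\<delta> = 0\<close>.\<close>

lemma (in skew_data) columns_independentI:
  assumes \<delta>: "\<delta> = zero_derivation n" and dom: "noncomm_domain (skew_ring n \<sigma> \<delta>)"
  shows "columns_independent n \<sigma>"
  unfolding columns_independent_def
proof (intro allI impI)
  fix r a and v :: "nat list \<Rightarrow> 'a"
  assume a: "a \<noteq> 0" and z: "\<forall>u\<in>words n r. (\<Sum>w\<in>words n r. word_entry \<sigma> u w a * v w) = 0"
  let ?S = "skew_ring n \<sigma> \<delta>"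
  define g where "g = (\<Sum>w\<in>words n r. Poly_Mapping.single w (v w))"
  have lg: "Poly_Mapping.lookup g w = (if w \<in> words n r then v w else 0)" for w
    using finite_words[of n r] by (simp add: g_def lookup_sum lookup_single when_def)
  have gc: "g \<in> skew_carrier n" by (auto simp: in_keys_iff lg split: if_splits)
  have c: "skew_act n \<sigma> \<delta> a g \<in> skew_carrier n" by (rule skew_carrier_act[OF gc])
  have "skew_act n \<sigma> \<delta> a g = 0"
  proof (rule poly_mapping_eqI)
    fix u
    show "Poly_Mapping.lookup (skew_act n \<sigma> \<delta> a g) u = Poly_Mapping.lookup 0 u"
    proof (cases "u \<in> lists {..<n}")
      case True
      then have "Poly_Mapping.lookup (skew_act n \<sigma> \<delta> a g) u =
          (\<Sum>w\<in>words n (length u). word_entry \<sigma> u w a * Poly_Mapping.lookup g w)"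
        using gc \<delta> by (intro lookup_skew_act) auto
      \<comment> \<open>Since \<open>g\<close> is homogeneous of degree \<open>r\<close>, only words
        \<open>u\<close> of length \<open>r\<close> matter, and for these the sum is the assumed
        relation.\<close>
      also have "\<dots> = (\<Sum>w\<in>words n (length u). if length u = r then word_entry \<sigma> u w a * v w else 0)"
        by (intro sum.cong) (auto simp: lg)
      also have "\<dots> = 0"
      proof (cases "length u = r")
        case eq: True
        then have "u \<in> words n r" using True by blast
        from bspec[OF z this] show ?thesis by (simp only: eq simp_thms if_True)
      qed simp
      finally show ?thesis by simp
    next
      case False
      then show ?thesis using c by (auto simp: in_keys_iff)
    qed
  qed
  then have "Poly_Mapping.single [] a \<otimes>\<^bsub>?S\<^esub> g = \<zero>\<^bsub>?S\<^esub>"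
    by (simp add: S_simps[OF hom der] M_single[OF hom der])
  moreover have "Poly_Mapping.single [] a \<in> carrier ?S" "g \<in> carrier ?S"
    using gc by (auto simp: skew_ring_def)
  ultimately have "Poly_Mapping.single [] a = \<zero>\<^bsub>?S\<^esub> \<or> g = \<zero>\<^bsub>?S\<^esub>"
    using dom unfolding noncomm_domain_def by blast
  then have "Poly_Mapping.single ([] :: nat list) a = 0 \<or> g = 0" by (simp add: skew_ring_def)
  then have "g = 0" using a by (metis lookup_single_eq lookup_zero)
  then show "\<forall>w\<in>words n r. v w = 0" using lg by (metis lookup_zero)
qed

section \<open>Evaluation in a free skew extension\<close>

text \<open>The same data in an abstract extension and in the explicit ring, so that the two can be
  compared.\<close>

locale skew_evaluation = free_skew_extension S n \<sigma> \<delta> \<iota> x + skew_data n \<sigma> \<delta>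
  for S :: "('b, 'm) ring_scheme" (structure) and n :: nat
    and \<sigma> \<delta> :: "'a::ring_1 \<Rightarrow> 'a mat" and \<iota> :: "'a \<Rightarrow> 'b" and x :: "nat \<Rightarrow> 'b"
begin

lemma iota_closed [simp]: "\<iota> r \<in> carrier S"
  using ring_hom_closed[OF embedding_hom, of r] by simp

lemma iota_add: "\<iota> (r + s) = \<iota> r \<oplus> \<iota> s"
  using ring_hom_add[OF embedding_hom, of r s] by simp

lemma iota_mult: "\<iota> (r * s) = \<iota> r \<otimes> \<iota> s"
  using ring_hom_mult[OF embedding_hom, of r s] by simp

lemma iota_one: "\<iota> 1 = \<one>"
  using ring_hom_one[OF embedding_hom] by simp

lemma iota_zero: "\<iota> 0 = \<zero>"
proof -
  have "\<iota> 0 \<oplus> \<iota> 0 = \<iota> 0" using iota_add[of 0 0] by simp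
  then show ?thesis by (metis add.l_cancel_one iota_closed)
qed

lemma gen_closed: "i < n \<Longrightarrow> x i \<in> carrier S"
  using generators_closed by auto

lemma word_prod_Cons: "word_prod S x (i # w) = x i \<otimes> word_prod S x w"
  by (simp add: word_prod_def)

lemma word_prod_Nil: "word_prod S x [] = \<one>"
  by (simp add: word_prod_def)

lemma word_prod_closed: "w \<in> lists {..<n} \<Longrightarrow> word_prod S x w \<in> carrier S"
  by (induction w rule: list.induct) (simp_all add: word_prod_Cons word_prod_Nil gen_closed)

lemma monomial_funcset:
  assumes "U \<subseteq> lists {..<n}"
  shows "(\<lambda>w. word_prod S x w \<otimes> \<iota> (c w)) \<in> U \<rightarrow> carrier S"
  by (intro Pi_I m_closed iota_closed word_prod_closed subsetD[OF assms])

text \<open>The canonical comparison map from \<open>skew_ring\<close> to \<open>S\<close>, which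
  turns out to be a ring isomorphism. Coefficients stand on the right because the monomials form a
  right basis.\<close>

definition evaluate :: "(nat list \<Rightarrow>\<^sub>0 'a) \<Rightarrow> 'b" where
  "evaluate f = (\<Oplus>w\<in>Poly_Mapping.keys f. word_prod S x w \<otimes> \<iota> (Poly_Mapping.lookup f w))"

text \<open>Terms outside the support vanish, so elements with different supports can be summed over
  one index set.\<close>

lemma evaluate_superset:
  assumes "finite U" "Poly_Mapping.keys f \<subseteq> U" "U \<subseteq> lists {..<n}"
  shows "evaluate f = (\<Oplus>w\<in>U. word_prod S x w \<otimes> \<iota> (Poly_Mapping.lookup f w))"
  unfolding evaluate_def
proof (rule add.finprod_mono_neutral_cong_left[OF assms(1,2)])
  fix w assume w: "w \<in> U - Poly_Mapping.keys f"
  then have "w \<in> lists {..<n}" using assms(3) by blast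
  then show "word_prod S x w \<otimes> \<iota> (Poly_Mapping.lookup f w) = \<zero>"
    using w by (simp add: in_keys_iff iota_zero word_prod_closed)
qed (simp_all add: monomial_funcset[OF assms(3)])

lemma evaluate_closed: "f \<in> skew_carrier n \<Longrightarrow> evaluate f \<in> carrier S"
  unfolding evaluate_def by (rule finsum_closed, rule monomial_funcset) simp

lemma evaluate_zero: "evaluate 0 = \<zero>"
  by (simp add: evaluate_def)

lemma evaluate_single:
  "w \<in> lists {..<n} \<Longrightarrow> evaluate (Poly_Mapping.single w r) = word_prod S x w \<otimes> \<iota> r"
  by (subst evaluate_superset[of "{w}"]) (simp_all add: word_prod_closed)

lemma evaluate_add:
  assumes "f \<in> skew_carrier n" "g \<in> skew_carrier n"
  shows "evaluate (f + g) = evaluate f \<oplus> evaluate g"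
proof -
  let ?U = "Poly_Mapping.keys f \<union> Poly_Mapping.keys g"
  let ?t = "\<lambda>h w. word_prod S x w \<otimes> \<iota> (Poly_Mapping.lookup h w)"
  have U: "finite ?U" "?U \<subseteq> lists {..<n}" using assms by auto
  have c: "?t h \<in> ?U \<rightarrow> carrier S" for h by (rule monomial_funcset[OF U(2)])
  have "evaluate (f + g) = (\<Oplus>w\<in>?U. ?t (f + g) w)"
    by (rule evaluate_superset[OF U(1) keys_add U(2)])
  also have "\<dots> = (\<Oplus>w\<in>?U. ?t f w \<oplus> ?t g w)"
  proof (rule finsum_cong')
    fix w assume "w \<in> ?U"
    then have "word_prod S x w \<in> carrier S" using U(2) word_prod_closed by blast
    then show "?t (f + g) w = ?t f w \<oplus> ?t g w"
      by (simp add: lookup_add iota_add r_distr)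
  qed (use c in auto)
  also have "\<dots> = (\<Oplus>w\<in>?U. ?t f w) \<oplus> (\<Oplus>w\<in>?U. ?t g w)"
    using c by (rule finsum_addf[OF _ c])
  also have "(\<Oplus>w\<in>?U. ?t f w) = evaluate f"
    by (rule evaluate_superset[symmetric]) (use U in auto)
  also have "(\<Oplus>w\<in>?U. ?t g w) = evaluate g"
    by (rule evaluate_superset[symmetric]) (use U in auto)
  finally show ?thesis .
qed

lemma evaluate_sum:
  "finite I \<Longrightarrow> (\<And>i. i \<in> I \<Longrightarrow> f i \<in> skew_carrier n) \<Longrightarrow>
    evaluate (sum f I) = (\<Oplus>i\<in>I. evaluate (f i))"
proof (induction I rule: finite_induct)
  case empty
  then show ?case by (simp add: evaluate_zero)
next
  case (insert i I)
  have c: "(\<lambda>i. evaluate (f i)) \<in> I \<rightarrow> carrier S" "evaluate (f i) \<in> carrier S"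
    using insert.prems evaluate_closed by auto
  have "evaluate (sum f (insert i I)) = evaluate (f i + sum f I)" using insert.hyps by simp
  also have "\<dots> = evaluate (f i) \<oplus> evaluate (sum f I)"
    by (intro evaluate_add skew_carrier_sum insert.prems) auto
  also have "evaluate (sum f I) = (\<Oplus>i\<in>I. evaluate (f i))"
    by (intro insert.IH insert.prems) auto
  finally show ?case using finsum_insert[OF insert.hyps c] by simp
qed

lemma evaluate_pre:
  assumes "i < n" "f \<in> skew_carrier n"
  shows "evaluate (skew_pre i f) = x i \<otimes> evaluate f"
  using assms(2)
proof (induction f rule: skew_carrier_induct)
  case (single w r)
  then have "i # w \<in> lists {..<n}" using assms(1) by simp
  with single show ?case
    using assms(1) by (simp add: pre_single evaluate_single word_prod_Cons m_assoc gen_closed word_prod_closed)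
next
  case (add f g)
  have "evaluate (skew_pre i (f + g)) = evaluate (skew_pre i f) \<oplus> evaluate (skew_pre i g)"
    unfolding is_additiveD[OF pre_add]
    by (intro evaluate_add skew_carrier_pre assms(1) add.hyps)
  also have "\<dots> = x i \<otimes> evaluate (f + g)"
    unfolding add.IH evaluate_add[OF add.hyps]
    by (intro r_distr[symmetric] gen_closed assms(1) evaluate_closed add.hyps)
  finally show ?case .
qed

lemma evaluate_foldr_pre:
  assumes "u \<in> lists {..<n}" "f \<in> skew_carrier n"
  shows "evaluate (foldr skew_pre u f) = word_prod S x u \<otimes> evaluate f"
  using assms(1)
proof (induction u rule: list.induct)
  case Nil
  then show ?case using evaluate_closed[OF assms(2)] by (simp add: word_prod_Nil)
next
  case (Cons i u)
  then have i: "i < n" and u: "u \<in> lists {..<n}" by simp_all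
  have "evaluate (foldr skew_pre (i # u) f) = x i \<otimes> evaluate (foldr skew_pre u f)"
    using evaluate_pre[OF i skew_carrier_foldr_pre[OF u assms(2)]] by simp
  also have "\<dots> = word_prod S x (i # u) \<otimes> evaluate f"
    unfolding Cons.IH[OF u] word_prod_Cons
    by (intro m_assoc[symmetric] gen_closed i word_prod_closed u evaluate_closed assms(2))
  finally show ?case .
qed

text \<open>Moving \<open>r\<close> past the first letter is \<open>A_pre\<close> in the explicit
  ring and \<open>commutation\<close> in \<open>S\<close>. The two have the same shape, and the
  induction hypothesis covers the remaining word for all scalars.\<close>

lemma evaluate_act_single:
  "w \<in> lists {..<n} \<Longrightarrow>
    evaluate (skew_act n \<sigma> \<delta> r (Poly_Mapping.single w s)) = \<iota> r \<otimes> evaluate (Poly_Mapping.single w s)"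
proof (induction w arbitrary: r rule: list.induct)
  case Nil
  then show ?case
    by (simp add: A_single[OF hom der] evaluate_single word_prod_Nil iota_mult)
next
  case (Cons j w)
  let ?h = "Poly_Mapping.single w s"
  let ?A = "skew_act n \<sigma> \<delta>"
  from Cons have j: "j < n" and w: "w \<in> lists {..<n}" by simp_all
  have h: "?h \<in> skew_carrier n" using w by (rule skew_carrier_single)
  have eh: "evaluate ?h \<in> carrier S" by (rule evaluate_closed[OF h])
  have pc: "skew_pre i (?A (\<sigma> r $$ (i, j)) ?h) \<in> skew_carrier n" if "i \<in> {..<n}" for i
    using that h by (intro skew_carrier_pre skew_carrier_act) auto
  have "evaluate (?A r (Poly_Mapping.single (j # w) s)) =
      evaluate ((\<Sum>i<n. skew_pre i (?A (\<sigma> r $$ (i, j)) ?h)) + ?A (\<delta> r $$ (0, j)) ?h)"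
    using A_pre[OF hom der, of r j ?h] j by (simp add: pre_single)
  also have "\<dots> = evaluate (\<Sum>i<n. skew_pre i (?A (\<sigma> r $$ (i, j)) ?h)) \<oplus> evaluate (?A (\<delta> r $$ (0, j)) ?h)"
    by (rule evaluate_add[OF skew_carrier_sum[OF pc] skew_carrier_act[OF h]])
  also have "evaluate (\<Sum>i<n. skew_pre i (?A (\<sigma> r $$ (i, j)) ?h)) =
      (\<Oplus>i\<in>{..<n}. evaluate (skew_pre i (?A (\<sigma> r $$ (i, j)) ?h)))"
    by (rule evaluate_sum[OF _ pc]) simp
  also have "\<dots> = (\<Oplus>i\<in>{..<n}. (x i \<otimes> \<iota> (\<sigma> r $$ (i, j))) \<otimes> evaluate ?h)"
  proof (rule finsum_cong')
    fix i assume "i \<in> {..<n}"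
    then have i: "i < n" by simp
    have "evaluate (skew_pre i (?A (\<sigma> r $$ (i, j)) ?h)) = x i \<otimes> (\<iota> (\<sigma> r $$ (i, j)) \<otimes> evaluate ?h)"
      unfolding evaluate_pre[OF i skew_carrier_act[OF h]] Cons.IH[OF w] ..
    then show "evaluate (skew_pre i (?A (\<sigma> r $$ (i, j)) ?h)) = (x i \<otimes> \<iota> (\<sigma> r $$ (i, j))) \<otimes> evaluate ?h"
      using i eh by (simp add: m_assoc gen_closed)
  qed (use eh gen_closed in auto)
  also have "\<dots> = (\<Oplus>i\<in>{..<n}. x i \<otimes> \<iota> (\<sigma> r $$ (i, j))) \<otimes> evaluate ?h"
    by (rule finsum_ldistr[symmetric]) (use eh gen_closed in auto)
  also have "evaluate (?A (\<delta> r $$ (0, j)) ?h) = \<iota> (\<delta> r $$ (0, j)) \<otimes> evaluate ?h"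
    by (rule Cons.IH[OF w])
  also have "(\<Oplus>i\<in>{..<n}. x i \<otimes> \<iota> (\<sigma> r $$ (i, j))) \<otimes> evaluate ?h \<oplus> \<iota> (\<delta> r $$ (0, j)) \<otimes> evaluate ?h
      = ((\<Oplus>i\<in>{..<n}. x i \<otimes> \<iota> (\<sigma> r $$ (i, j))) \<oplus> \<iota> (\<delta> r $$ (0, j))) \<otimes> evaluate ?h"
    by (rule l_distr[symmetric]) (use eh gen_closed in \<open>auto intro!: finsum_closed\<close>)
  \<comment> \<open>The commutation rule of \<open>S\<close> is read from right to left.\<close>
  also have "\<dots> = (\<iota> r \<otimes> x j) \<otimes> evaluate ?h"
    unfolding commutation[OF j] ..
  also have "\<dots> = \<iota> r \<otimes> evaluate (Poly_Mapping.single (j # w) s)"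
    using evaluate_pre[OF j h] j eh by (simp add: pre_single m_assoc gen_closed)
  finally show ?case .
qed

lemma evaluate_act:
  "f \<in> skew_carrier n \<Longrightarrow> evaluate (skew_act n \<sigma> \<delta> r f) = \<iota> r \<otimes> evaluate f"
proof (induction f rule: skew_carrier_induct)
  case (single w s)
  then show ?case by (rule evaluate_act_single)
next
  case (add f g)
  show ?case
    unfolding is_additiveD[OF A_add[OF hom der]] evaluate_add[OF add.hyps]
      evaluate_add[OF skew_carrier_act[OF add.hyps(1)] skew_carrier_act[OF add.hyps(2)]] add.IH
    by (intro r_distr[symmetric] iota_closed evaluate_closed add.hyps)
qed

text \<open>A term of the left factor is a word times a scalar: \<open>evaluate_act\<close> treats
  the scalar, \<open>evaluate_foldr_pre\<close> the word, and additivity does the rest.\<close>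

lemma evaluate_mult:
  assumes "f \<in> skew_carrier n" and g: "g \<in> skew_carrier n"
  shows "evaluate (skew_mult n \<sigma> \<delta> f g) = evaluate f \<otimes> evaluate g"
  using assms(1)
proof (induction f rule: skew_carrier_induct)
  case (single u s)
  show ?case
    unfolding M_single[OF hom der] evaluate_foldr_pre[OF single skew_carrier_act[OF g]]
      evaluate_act[OF g] evaluate_single[OF single]
    by (intro m_assoc[symmetric] iota_closed evaluate_closed word_prod_closed single g)
next
  case (add f h)
  show ?case
    unfolding is_additiveD[OF M_add_left[OF hom der]] evaluate_add[OF add.hyps]
      evaluate_add[OF skew_carrier_mult[OF add.hyps(1) g] skew_carrier_mult[OF add.hyps(2) g]] add.IH
    by (intro l_distr[symmetric] evaluate_closed add.hyps g)
qed

lemma evaluate_one: "evaluate (Poly_Mapping.single [] 1) = \<one>"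
  by (simp add: evaluate_single word_prod_Nil iota_one)

lemma evaluate_diff:
  assumes "f \<in> skew_carrier n" "g \<in> skew_carrier n"
  shows "f - g \<in> skew_carrier n" "evaluate (f - g) = evaluate f \<ominus> evaluate g"
proof -
  show d: "f - g \<in> skew_carrier n" using keys_diff[of f g] assms by blast
  \<comment> \<open>Adding \<open>g\<close> back reduces the claim to additivity.\<close>
  have "evaluate f = evaluate (f - g) \<oplus> evaluate g"
    using evaluate_add[OF d assms(2)] by simp
  then show "evaluate (f - g) = evaluate f \<ominus> evaluate g"
    using evaluate_closed[OF d] evaluate_closed[OF assms(2)] by (simp add: a_minus_def a_assoc r_neg)
qed

section \<open>Bijectivity of the evaluation\<close>

lemma word_prod_inj: "U \<subseteq> lists {..<n} \<Longrightarrow> inj_on (word_prod S x) U"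
  using monoid_free by (rule inj_on_subset)

text \<open>Spans and independence sum over sets of monomials, \<open>evaluate\<close> over words;
  injectivity of \<open>word_prod\<close> identifies the two.\<close>

lemma finsum_word_prod_image:
  assumes "U \<subseteq> lists {..<n}"
  shows "(\<Oplus>b\<in>word_prod S x ` U. b \<otimes> \<iota> (c b)) = (\<Oplus>w\<in>U. word_prod S x w \<otimes> \<iota> (c (word_prod S x w)))"
proof (rule finsum_reindex[OF _ word_prod_inj[OF assms]])
  show "(\<lambda>b. b \<otimes> \<iota> (c b)) \<in> word_prod S x ` U \<rightarrow> carrier S"
    using subsetD[OF assms, THEN word_prod_closed] by auto
qed

text \<open>Right independence takes a coefficient function on monomials; inverting
  \<open>word_prod\<close> supplies it.\<close>

lemma evaluate_eq_finsum_image: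
  assumes "f \<in> skew_carrier n"
  shows "evaluate f = (\<Oplus>b\<in>word_prod S x ` Poly_Mapping.keys f.
    b \<otimes> \<iota> (Poly_Mapping.lookup f (the_inv_into (lists {..<n}) (word_prod S x) b)))"
proof -
  have k: "Poly_Mapping.keys f \<subseteq> lists {..<n}" using assms by simp
  have "evaluate f = (\<Oplus>w\<in>Poly_Mapping.keys f. word_prod S x w \<otimes>
      \<iota> (Poly_Mapping.lookup f (the_inv_into (lists {..<n}) (word_prod S x) (word_prod S x w))))"
    unfolding evaluate_def
  proof (rule finsum_cong')
    fix w assume "w \<in> Poly_Mapping.keys f"
    then have "w \<in> lists {..<n}" using k by blast
    then show "word_prod S x w \<otimes> \<iota> (Poly_Mapping.lookup f w) = word_prod S x w \<otimes>
      \<iota> (Poly_Mapping.lookup f (the_inv_into (lists {..<n}) (word_prod S x) (word_prod S x w)))"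
      by (simp add: the_inv_into_f_f[OF monoid_free])
  qed (simp_all add: monomial_funcset[OF k])
  then show ?thesis using finsum_word_prod_image[OF k] by simp
qed

lemma evaluate_eq_zeroD:
  assumes f: "f \<in> skew_carrier n" and z: "evaluate f = \<zero>"
  shows "f = 0"
proof -
  have k: "Poly_Mapping.keys f \<subseteq> lists {..<n}" using f by simp
  let ?A = "word_prod S x ` Poly_Mapping.keys f"
  let ?c = "\<lambda>b. Poly_Mapping.lookup f (the_inv_into (lists {..<n}) (word_prod S x) b)"
  have "right_independent S \<iota> (word_prod S x ` lists {..<n})"
    using monoid_basis by (simp add: right_basis_def)
  moreover have "(\<Oplus>b\<in>?A. b \<otimes> \<iota> (?c b)) = \<zero>"
    using evaluate_eq_finsum_image[OF f] z by simp
  moreover have "?A \<subseteq> word_prod S x ` lists {..<n}" using k by (rule image_mono)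
  moreover have "finite ?A" by simp
  ultimately have all: "\<forall>b\<in>?A. ?c b = 0"
    unfolding right_independent_def by (elim allE[of _ ?A] allE[of _ ?c] impE)
  have "w \<notin> Poly_Mapping.keys f" for w
  proof
    assume w: "w \<in> Poly_Mapping.keys f"
    then have "w \<in> lists {..<n}" using k by blast
    then have "Poly_Mapping.lookup f w = 0"
      using bspec[OF all imageI[OF w]] by (simp add: the_inv_into_f_f[OF monoid_free])
    then show False using w by (simp add: in_keys_iff)
  qed
  then show ?thesis by (metis all_not_in_conv keys_eq_empty)
qed

lemma evaluate_inj: "inj_on evaluate (skew_carrier n)"
proof (rule inj_onI)
  fix f g assume fg: "f \<in> skew_carrier n" "g \<in> skew_carrier n" "evaluate f = evaluate g"
  have "evaluate (f - g) = \<zero>"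
    unfolding evaluate_diff(2)[OF fg(1,2)] fg(3)
    using evaluate_closed[OF fg(2)] by (simp add: a_minus_def r_neg)
  from evaluate_eq_zeroD[OF evaluate_diff(1)[OF fg(1,2)] this] show "f = g" by simp
qed

text \<open>This serves twice: all words give surjectivity of \<open>evaluate\<close>, words of
  bounded length give the degree filtration.\<close>

lemma right_span_word_prod:
  assumes L: "L \<subseteq> lists {..<n}"
  shows "right_span S \<iota> (word_prod S x ` L) = evaluate ` {f. Poly_Mapping.keys f \<subseteq> L}"
proof (intro equalityI subsetI)
  fix y assume "y \<in> right_span S \<iota> (word_prod S x ` L)"
  then obtain A c where A: "finite A" "A \<subseteq> word_prod S x ` L" and y: "y = (\<Oplus>b\<in>A. b \<otimes> \<iota> (c b))"
    unfolding right_span_def by blast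
  obtain U where U: "U \<subseteq> L" "A = word_prod S x ` U" using A(2) by (meson subset_imageE)
  have Ul: "U \<subseteq> lists {..<n}" using U(1) L by blast
  have fin: "finite U" using A(1) U(2) word_prod_inj[OF Ul] finite_imageD by blast
  let ?f = "\<Sum>w\<in>U. Poly_Mapping.single w (c (word_prod S x w))"
  have lf: "Poly_Mapping.lookup ?f w = (if w \<in> U then c (word_prod S x w) else 0)" for w
    using fin by (simp add: lookup_sum lookup_single when_def)
  \<comment> \<open>Some coefficients \<open>c\<close> may be zero, so \<open>U\<close> can exceed
    the support and only an inclusion holds.\<close>
  have k: "Poly_Mapping.keys ?f \<subseteq> U" by (auto simp: in_keys_iff lf split: if_splits)
  have "evaluate ?f = (\<Oplus>w\<in>U. word_prod S x w \<otimes> \<iota> (Poly_Mapping.lookup ?f w))"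
    by (rule evaluate_superset[OF fin k Ul])
  also have "\<dots> = (\<Oplus>w\<in>U. word_prod S x w \<otimes> \<iota> (c (word_prod S x w)))"
    by (rule finsum_cong'[OF refl monomial_funcset[OF Ul]]) (simp add: lf)
  also have "\<dots> = y" unfolding y U(2) by (rule finsum_word_prod_image[OF Ul, symmetric])
  finally show "y \<in> evaluate ` {f. Poly_Mapping.keys f \<subseteq> L}" using k U(1) by blast
next
  fix y assume "y \<in> evaluate ` {f. Poly_Mapping.keys f \<subseteq> L}"
  then obtain f where f: "Poly_Mapping.keys f \<subseteq> L" "y = evaluate f" by blast
  then have "f \<in> skew_carrier n" using L by blast
  from evaluate_eq_finsum_image[OF this] show "y \<in> right_span S \<iota> (word_prod S x ` L)"
    unfolding right_span_def f(2) using f(1)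
    by (intro CollectI exI[of _ "word_prod S x ` Poly_Mapping.keys f"] exI conjI) auto
qed

lemma evaluate_image: "evaluate ` skew_carrier n = carrier S"
  using right_span_word_prod[OF order_refl] monoid_basis by (simp add: right_basis_def)

section \<open>The degree in an abstract extension\<close>

lemma evaluate_in_deg_filtration:
  assumes f: "f \<in> skew_carrier n"
  shows "evaluate f \<in> deg_filtration S n \<iota> x m \<longleftrightarrow> (\<forall>w\<in>Poly_Mapping.keys f. length w \<le> m)"
proof -
  have L: "{w \<in> lists {..<n}. length w \<le> m} \<subseteq> lists {..<n}" by blast
  show ?thesis
    unfolding deg_filtration_def right_span_word_prod[OF L]
  proof
    assume "evaluate f \<in> evaluate ` {f. Poly_Mapping.keys f \<subseteq> {w \<in> lists {..<n}. length w \<le> m}}"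
    then obtain g where g: "Poly_Mapping.keys g \<subseteq> {w \<in> lists {..<n}. length w \<le> m}"
      "evaluate f = evaluate g" by blast
    then have "g \<in> skew_carrier n" by blast
    \<comment> \<open>Injectivity of \<open>evaluate\<close> shows that the representation by short
      words is the given one.\<close>
    then have "f = g" using inj_onD[OF evaluate_inj g(2) f] by blast
    then show "\<forall>w\<in>Poly_Mapping.keys f. length w \<le> m" using g(1) by blast
  next
    assume "\<forall>w\<in>Poly_Mapping.keys f. length w \<le> m"
    then show "evaluate f \<in> evaluate ` {f. Poly_Mapping.keys f \<subseteq> {w \<in> lists {..<n}. length w \<le> m}}"
      using f by (intro imageI) auto
  qed
qed

lemma skew_deg_evaluate:
  assumes f: "f \<in> skew_carrier n"
  shows "skew_deg S n \<iota> x (evaluate f) = (if f = 0 then Minf else Fin (word_deg f))"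
proof (cases "f = 0")
  case True
  then show ?thesis by (simp add: skew_deg_def evaluate_zero)
next
  case False
  then have "evaluate f \<noteq> \<zero>" using evaluate_eq_zeroD[OF f] by blast
  moreover have "(LEAST m. evaluate f \<in> deg_filtration S n \<iota> x m) = word_deg f"
  proof (rule Least_equality)
    show "evaluate f \<in> deg_filtration S n \<iota> x (word_deg f)"
      unfolding evaluate_in_deg_filtration[OF f] using word_deg_ge by blast
    fix m assume "evaluate f \<in> deg_filtration S n \<iota> x m"
    then show "word_deg f \<le> m"
      unfolding evaluate_in_deg_filtration[OF f] using word_deg_attained[OF False] by metis
  qed
  ultimately show ?thesis using False by (simp add: skew_deg_def)
qed

text \<open>Surjectivity of \<open>evaluate\<close> and \<open>skew_deg_evaluate\<close> reduce each
  law to \<open>word_deg\<close> in the explicit ring.\<close>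

theorem degree_function_skew_deg:
  assumes ind: "columns_independent n \<sigma>"
  shows "degree_function S (skew_deg S n \<iota> x)"
proof -
  let ?d = "skew_deg S n \<iota> x"
  have ex: "\<exists>f\<in>skew_carrier n. y = evaluate f" if "y \<in> carrier S" for y
    using that evaluate_image by blast
  have mult: "?d (y \<otimes> z) = ?d y + ?d z" if yz: "y \<in> carrier S" "z \<in> carrier S" for y z
  proof -
    from ex[OF yz(1)] obtain f where f: "f \<in> skew_carrier n" "y = evaluate f" by blast
    from ex[OF yz(2)] obtain g where g: "g \<in> skew_carrier n" "z = evaluate g" by blast
    have m: "?d (y \<otimes> z) = (if skew_mult n \<sigma> \<delta> f g = 0 then Minf else Fin (word_deg (skew_mult n \<sigma> \<delta> f g)))"
      unfolding f(2) g(2) evaluate_mult[OF f(1) g(1), symmetric]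
      by (rule skew_deg_evaluate[OF skew_carrier_mult[OF f(1) g(1)]])
    have fg: "?d y = (if f = 0 then Minf else Fin (word_deg f))" "?d z = (if g = 0 then Minf else Fin (word_deg g))"
      unfolding f(2) g(2) by (rule skew_deg_evaluate[OF f(1)], rule skew_deg_evaluate[OF g(1)])
    \<comment> \<open>A zero factor makes both sides \<open>Minf\<close>.\<close>
    have "skew_mult n \<sigma> \<delta> f g = 0" if "f = 0 \<or> g = 0"
      using that is_additive_0[OF M_add_left[OF hom der]] is_additive_0[OF M_add_right[OF hom der]] by blast
    then show ?thesis
      unfolding m fg using word_deg_skew_mult[OF ind f(1) _ g(1)] by auto
  qed
  have diff: "?d (y \<ominus> z) \<le> max (?d y) (?d z)" if yz: "y \<in> carrier S" "z \<in> carrier S" for y z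
  proof -
    from ex[OF yz(1)] obtain f where f: "f \<in> skew_carrier n" "y = evaluate f" by blast
    from ex[OF yz(2)] obtain g where g: "g \<in> skew_carrier n" "z = evaluate g" by blast
    have m: "?d (y \<ominus> z) = (if f - g = 0 then Minf else Fin (word_deg (f - g)))"
      unfolding f(2) g(2) evaluate_diff(2)[OF f(1) g(1), symmetric]
      by (rule skew_deg_evaluate[OF evaluate_diff(1)[OF f(1) g(1)]])
    have fg: "?d y = (if f = 0 then Minf else Fin (word_deg f))" "?d z = (if g = 0 then Minf else Fin (word_deg g))"
      unfolding f(2) g(2) by (rule skew_deg_evaluate[OF f(1)], rule skew_deg_evaluate[OF g(1)])
    \<comment> \<open>If \<open>f\<close> is zero, the difference is \<open>- g\<close>, which has
      the degree of \<open>g\<close>.\<close>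
    show ?thesis unfolding m fg using word_deg_diff[of f g] by (auto simp: word_deg_uminus)
  qed
  have one: "?d \<one> = 0"
  proof -
    have "(Poly_Mapping.single [] 1 :: nat list \<Rightarrow>\<^sub>0 'a) \<noteq> 0" by (metis lookup_single_eq lookup_zero zero_neq_one)
    then show ?thesis
      using skew_deg_evaluate[of "Poly_Mapping.single [] 1"]
      by (simp add: evaluate_one word_deg_def zero_extended_def)
  qed
  have "?d y \<noteq> Pinf" for y by (simp add: skew_deg_def)
  moreover have "?d y \<ge> 0" if "y \<noteq> \<zero>" for y
    using that by (simp add: skew_deg_def zero_extended_def)
  moreover have "?d \<zero> = Minf" by (simp add: skew_deg_def)
  \<comment> \<open>The product inequality of a pseudo-valuation follows from the equality
    \<open>mult\<close>.\<close>
  ultimately show ?thesis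
    unfolding degree_function_def pseudo_valuation_def using mult diff one by simp
qed

end

text \<open>Degrees of nonzero elements are natural numbers and so are their sums, whereas zero has
  degree \<open>Minf\<close>. The unit has degree 0 and hence differs from zero.\<close>

lemma degree_function_imp_noncomm_domain:
  assumes "ring S" and d: "degree_function S (skew_deg S n \<iota> x)"
  shows "noncomm_domain S"
proof -
  interpret ring S by fact
  let ?d = "skew_deg S n \<iota> x"
  have zero: "y = \<zero>\<^bsub>S\<^esub>" if "?d y = Minf" for y
    using that by (auto simp: skew_deg_def split: if_splits)
  have fin: "\<exists>k. ?d y = Fin k" if "y \<noteq> \<zero>\<^bsub>S\<^esub>" for y
    using that by (simp add: skew_deg_def)
  have d0: "?d \<zero>\<^bsub>S\<^esub> = Minf" by (simp add: skew_deg_def)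
  have "?d \<one>\<^bsub>S\<^esub> = 0" using d unfolding degree_function_def pseudo_valuation_def by blast
  then have "\<one>\<^bsub>S\<^esub> \<noteq> \<zero>\<^bsub>S\<^esub>" using d0 by (auto simp: zero_extended_def)
  moreover have "y = \<zero>\<^bsub>S\<^esub> \<or> z = \<zero>\<^bsub>S\<^esub>"
    if yz: "y \<in> carrier S" "z \<in> carrier S" "y \<otimes>\<^bsub>S\<^esub> z = \<zero>\<^bsub>S\<^esub>" for y z
  proof (rule ccontr)
    assume "\<not> ?thesis"
    then obtain k l where "?d y = Fin k" "?d z = Fin l" using fin by blast
    moreover have "?d (y \<otimes>\<^bsub>S\<^esub> z) = ?d y + ?d z"
      using d yz(1,2) unfolding degree_function_def by blast
    ultimately show False using d0 yz(3) by simp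
  qed
  ultimately show ?thesis unfolding noncomm_domain_def using assms(1) by blast
qed

section \<open>Equivalence of the three conditions\<close>

lemma right_derivation_zero:
  assumes "\<And>r. \<sigma> r \<in> carrier_mat n n"
  shows "right_derivation n \<sigma> (zero_derivation n)"
  unfolding right_derivation_def zero_derivation_def
  using left_mult_zero_mat[OF assms, of 1] by auto

theorem corollary3p8:
  fixes n :: nat and \<sigma> :: "'a::ring_1 \<Rightarrow> 'a mat"
  assumes n: "n \<ge> 1"
    and \<sigma>: "\<sigma> \<in> Ring.ring_hom class_ring (ring_mat TYPE('a) n ())"
  shows
    "(megainjective n \<sigma> \<longleftrightarrow>
       (\<forall>\<delta>. right_derivation n \<sigma> \<delta> \<longrightarrow>
          (\<forall>(S :: (nat list \<Rightarrow>\<^sub>0 'a) ring) \<iota> x. free_skew_extension S n \<sigma> \<delta> \<iota> x \<longrightarrow>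
             degree_function S (skew_deg S n \<iota> x)))) \<and>
     (megainjective n \<sigma> \<longleftrightarrow>
       (\<forall>(S :: (nat list \<Rightarrow>\<^sub>0 'a) ring) \<iota> x.
          free_skew_extension S n \<sigma> (zero_derivation n) \<iota> x \<longrightarrow> noncomm_domain S)) \<and>
     ((\<forall>(S :: (nat list \<Rightarrow>\<^sub>0 'a) ring) \<iota> x.
          free_skew_extension S n \<sigma> (zero_derivation n) \<iota> x \<longrightarrow> noncomm_domain S) \<longrightarrow>
       (\<forall>\<delta>. right_derivation n \<sigma> \<delta> \<longrightarrow>
          (\<forall>(S :: (nat list \<Rightarrow>\<^sub>0 'a) ring) \<iota> x.
             free_skew_extension S n \<sigma> \<delta> \<iota> x \<longrightarrow> noncomm_domain S)))"
    (is "(?a \<longleftrightarrow> ?b) \<and> (?a \<longleftrightarrow> ?c) \<and> (?c \<longrightarrow> ?d)")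
proof -
  have car: "\<sigma> r \<in> carrier_mat n n" for r
    using \<sigma> by (auto simp: Ring.ring_hom_def ring_mat_simps)
  have zero: "right_derivation n \<sigma> (zero_derivation n)"
    using right_derivation_zero[of \<sigma> n] car by blast
  have domain: "noncomm_domain S"
    if "free_skew_extension S n \<sigma> \<delta> \<iota> x" "degree_function S (skew_deg S n \<iota> x)"
    for S :: "(nat list \<Rightarrow>\<^sub>0 'a) ring" and \<delta> \<iota> x
    using degree_function_imp_noncomm_domain[OF free_skew_extension.axioms(1)[OF that(1)] that(2)] .
  have ab: ?b if ?a
  proof (intro allI impI)
    fix \<delta> \<iota> x and S :: "(nat list \<Rightarrow>\<^sub>0 'a) ring"
    assume "right_derivation n \<sigma> \<delta>" "free_skew_extension S n \<sigma> \<delta> \<iota> x"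
    then have "skew_evaluation S n \<sigma> \<delta> \<iota> x"
      using \<sigma> by (intro skew_evaluation.intro skew_data.intro)
    then show "degree_function S (skew_deg S n \<iota> x)"
      by (rule skew_evaluation.degree_function_skew_deg)
        (rule megainjective_imp_columns_independent[OF \<sigma> n that])
  qed
  have bd: ?d if ?b using that domain by blast
  have bc: ?c if ?b using bd[OF that] zero by blast
  have ca: ?a if c: ?c
  proof -
    \<comment> \<open>\<open>?c\<close> speaks of all extensions and yields something only if one
      exists; the explicit ring is such an extension.\<close>
    have "noncomm_domain (skew_ring n \<sigma> (zero_derivation n))"
      using c free_skew_extension_skew_ring[OF \<sigma> zero] by blast
    then have "columns_independent n \<sigma>"
      using skew_data.columns_independentI[OF skew_data.intro[OF \<sigma> zero]] by blast
    then show ?a by (rule columns_independent_imp_megainjective[OF \<sigma> n])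
  qed
  \<comment> \<open>\<open>?c\<close> implies \<open>?d\<close> by way of \<open>?a\<close> and
    \<open>?b\<close>.\<close>
  show ?thesis using ab bc bd ca by blast
qed

end
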